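(* Let $(R,\mathfrak m)$ be a noetherian local ring, $I\subseteq R$ an ideal and $h\in\mathbb N$ such that $H^l_I(R)\ne0\iff l=h$. Let $1\le h'\le h$ and let $r_1,\dots,r_{h'}\in I$ be an $R$-regular sequence that is also a $D(H^h_I(R))$-regular sequence. Furthermore, let $r_1',\dots,r_{h'}'\in I$ be such that $(r_1',\dots,r_{h'}')R=(r_1,\dots,r_{h'})R$. Then $r_1',\dots,r_{h'}'$ is a $D(H^h_I(R))$-regular sequence. In particular, any permutation of $r_1,\dots,r_{h'}$ is again a $D(H^h_I(R))$-regular sequence.
   Context: Rings are commutative with unit. $H^l_I(R)$ denotes the $l$-th local cohomology module of $R$ supported in $I$. $D(M):=\operatorname{Hom}_R(M,E_R(R/\mathfrak m))$ is the Matlis dual of an $R$-module $M$, where $E_R(R/\mathfrak m)$ is the $R$-injective hull of $R/\mathfrak m$. Regular sequences on a (not necessarily finitely generated) module $M$ are understood in the usual sense: each $r_i$ is a nonzerodivisor on $M/(r_1,\dots,r_{i-1})M$ and $M/(r_1,\dots,r_{h'})M\neq0$. *)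

theory Defs
  imports "HOL-Algebra.Algebra"
begin

text \<open>
  Modules are the records of \<^theory>\<open>HOL-Algebra.Module\<close>, which extend ring records; the fields
  \<^const>\<open>monoid.mult\<close> and \<^const>\<open>monoid.one\<close> of a module carry no meaning and are left unspecified below.
\<close>

locale noetherian_local_ring = cring R + noetherian_ring R + maximalideal \<mm> R
  for R (structure) and \<mm> +
  assumes maximal_unique: "maximalideal \<nn> R \<Longrightarrow> \<nn> = \<mm>"

definition zero_module :: "('a, 'b, 'm) module_scheme \<Rightarrow> bool" where
  "zero_module M \<longleftrightarrow> carrier M = {\<zero>\<^bsub>M\<^esub>}"

definition ring_module :: "('a, 'm) ring_scheme \<Rightarrow> ('a, 'a) module" where
  "ring_module R = \<lparr>carrier = carrier R, monoid.mult = undefined, one = undefined,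
     ring.zero = \<zero>\<^bsub>R\<^esub>, ring.add = ring.add R, smult = monoid.mult R\<rparr>"

definition quotient_module ::
    "('a, 'b, 'm) module_scheme \<Rightarrow> 'b set \<Rightarrow> ('a, 'b set) module" where
  "quotient_module M N = \<lparr>carrier = a_rcosets\<^bsub>M\<^esub> N, monoid.mult = undefined, one = undefined,
     ring.zero = N, ring.add = set_add M, smult = (\<lambda>r C. \<Union>x\<in>C. N +>\<^bsub>M\<^esub> (r \<odot>\<^bsub>M\<^esub> x))\<rparr>"

definition mod_hom ::
    "('a, 'r) ring_scheme \<Rightarrow> ('a, 'b, 'm) module_scheme \<Rightarrow> ('a, 'c, 'n) module_scheme
      \<Rightarrow> ('b \<Rightarrow> 'c) set" where
  "mod_hom R M N = {f \<in> carrier M \<rightarrow> carrier N.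
     (\<forall>x\<in>carrier M. \<forall>y\<in>carrier M. f (x \<oplus>\<^bsub>M\<^esub> y) = f x \<oplus>\<^bsub>N\<^esub> f y) \<and>
     (\<forall>r\<in>carrier R. \<forall>x\<in>carrier M. f (r \<odot>\<^bsub>M\<^esub> x) = r \<odot>\<^bsub>N\<^esub> f x)}"

text \<open>
  Elements of \<open>Hom\<^sub>R(M, N)\<close> are made extensional, so that equality of functions is
  equality on \<^term>\<open>carrier M\<close>.
\<close>

definition Hom_module ::
    "('a, 'r) ring_scheme \<Rightarrow> ('a, 'b, 'm) module_scheme \<Rightarrow> ('a, 'c, 'n) module_scheme
      \<Rightarrow> ('a, 'b \<Rightarrow> 'c) module" where
  "Hom_module R M N = \<lparr>carrier = mod_hom R M N \<inter> extensional (carrier M),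
     monoid.mult = undefined, one = undefined,
     ring.zero = (\<lambda>x\<in>carrier M. \<zero>\<^bsub>N\<^esub>),
     ring.add = (\<lambda>f g. \<lambda>x\<in>carrier M. f x \<oplus>\<^bsub>N\<^esub> g x),
     smult = (\<lambda>r f. \<lambda>x\<in>carrier M. r \<odot>\<^bsub>N\<^esub> f x)\<rparr>"

text \<open>
  The test modules \<open>A\<close>, \<open>B\<close> live on the type of the ring. This type contains the ideals of \<open>R\<close> and
  \<open>R\<close> itself, so by Baer's criterion the lifting property holds against monomorphisms of modules on
  arbitrary types; see \<open>injective_module_lift\<close> below.
\<close>

definition injective_module ::
    "('a, 'r) ring_scheme \<Rightarrow> ('a, 'b, 'm) module_scheme \<Rightarrow> bool" where
  "injective_module R E \<longleftrightarrow> module R E \<and>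
     (\<forall>(A :: ('a, 'a) module) (B :: ('a, 'a) module) i f.
        module R A \<and> module R B \<and> i \<in> mod_hom R A B \<and> inj_on i (carrier A) \<and> f \<in> mod_hom R A E
        \<longrightarrow> (\<exists>g\<in>mod_hom R B E. \<forall>x\<in>carrier A. g (i x) = f x))"

definition injective_hull ::
    "('a, 'r) ring_scheme \<Rightarrow> ('a, 'b, 'm) module_scheme \<Rightarrow> ('a, 'c, 'n) module_scheme
      \<Rightarrow> ('b \<Rightarrow> 'c) \<Rightarrow> bool" where
  "injective_hull R M E \<iota> \<longleftrightarrow> module R M \<and> injective_module R E \<and>
     \<iota> \<in> mod_hom R M E \<and> inj_on \<iota> (carrier M) \<and>
     (\<forall>N. submodule N R E \<and> N \<noteq> {\<zero>\<^bsub>E\<^esub>} \<longrightarrow> N \<inter> \<iota> ` carrier M \<noteq> {\<zero>\<^bsub>E\<^esub>})"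

text \<open>
  Here \<open>E\<close> is an injective hull of the residue field.
\<close>

definition matlis_dual ::
    "('a, 'r) ring_scheme \<Rightarrow> ('a, 'c, 'n) module_scheme \<Rightarrow> ('a, 'b, 'm) module_scheme
      \<Rightarrow> ('a, 'b \<Rightarrow> 'c) module" where
  "matlis_dual R E M = Hom_module R M E"

text \<open>
  \<open>0 \<rightarrow> M \<rightarrow> J 0 \<rightarrow> J 1 \<rightarrow> \<dots>\<close> is exact, with augmentation \<open>\<epsilon>\<close> and differentials
  \<open>d n : J n \<rightarrow> J (n + 1)\<close>.
\<close>

definition injective_resolution ::
    "('a, 'r) ring_scheme \<Rightarrow> ('a, 'b, 'm) module_scheme \<Rightarrow> ('b \<Rightarrow> 'c)
      \<Rightarrow> (nat \<Rightarrow> ('a, 'c, 'n) module_scheme) \<Rightarrow> (nat \<Rightarrow> 'c \<Rightarrow> 'c) \<Rightarrow> bool" where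
  "injective_resolution R M \<epsilon> J d \<longleftrightarrow> module R M \<and> (\<forall>n. injective_module R (J n)) \<and>
     \<epsilon> \<in> mod_hom R M (J 0) \<and> inj_on \<epsilon> (carrier M) \<and>
     (\<forall>n. d n \<in> mod_hom R (J n) (J (Suc n))) \<and>
     \<epsilon> ` carrier M = {x \<in> carrier (J 0). d 0 x = \<zero>\<^bsub>J (Suc 0)\<^esub>} \<and>
     (\<forall>n. d n ` carrier (J n) = {x \<in> carrier (J (Suc n)). d (Suc n) x = \<zero>\<^bsub>J (Suc (Suc n))\<^esub>})"

text \<open>
  \<open>\<Gamma>\<^sub>I(M)\<close>: the elements annihilated by a power of \<open>I\<close>, powers being taken in the monoid of ideals
  under the ideal product.
\<close>

definition torsion_part ::
    "('a, 'r) ring_scheme \<Rightarrow> 'a set \<Rightarrow> ('a, 'b, 'm) module_scheme \<Rightarrow> 'b set" where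
  "torsion_part R I M = {x \<in> carrier M.
     \<exists>n::nat. \<forall>a \<in> I [^]\<^bsub>ideals_set R\<^esub> n. a \<odot>\<^bsub>M\<^esub> x = \<zero>\<^bsub>M\<^esub>}"

text \<open>
  \<open>H\<^sup>l\<^sub>I(M)\<close>, the \<open>l\<close>-th right derived functor of \<open>\<Gamma>\<^sub>I\<close>, computed from an injective resolution
  \<open>(J, d)\<close> of \<open>M\<close>: the kernel of \<open>d l\<close> on \<open>\<Gamma>\<^sub>I(J l)\<close> modulo the image of \<open>\<Gamma>\<^sub>I(J (l - 1))\<close>, where
  \<open>J (-1) = 0\<close>.
\<close>

definition local_cohomology ::
    "('a, 'r) ring_scheme \<Rightarrow> 'a set \<Rightarrow> (nat \<Rightarrow> ('a, 'b, 'm) module_scheme)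
      \<Rightarrow> (nat \<Rightarrow> 'b \<Rightarrow> 'b) \<Rightarrow> nat \<Rightarrow> ('a, 'b set) module" where
  "local_cohomology R I J d l = quotient_module
     ((J l)\<lparr>carrier := {x \<in> torsion_part R I (J l). d l x = \<zero>\<^bsub>J (Suc l)\<^esub>}\<rparr>)
     (case l of 0 \<Rightarrow> {\<zero>\<^bsub>J 0\<^esub>} | Suc k \<Rightarrow> d k ` torsion_part R I (J k))"

definition ideal_smult ::
    "('a, 'r) ring_scheme \<Rightarrow> 'a set \<Rightarrow> ('a, 'b, 'm) module_scheme \<Rightarrow> 'b set" where
  "ideal_smult R \<aa> M =
     \<Inter>{N. submodule N R M \<and> (\<forall>a\<in>\<aa>. \<forall>x\<in>carrier M. a \<odot>\<^bsub>M\<^esub> x \<in> N)}"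

definition nonzerodivisor_on :: "('a, 'b, 'm) module_scheme \<Rightarrow> 'a \<Rightarrow> bool" where
  "nonzerodivisor_on M r \<longleftrightarrow> (\<forall>x\<in>carrier M. r \<odot>\<^bsub>M\<^esub> x = \<zero>\<^bsub>M\<^esub> \<longrightarrow> x = \<zero>\<^bsub>M\<^esub>)"

definition regular_sequence ::
    "('a, 'r) ring_scheme \<Rightarrow> ('a, 'b, 'm) module_scheme \<Rightarrow> 'a list \<Rightarrow> bool" where
  "regular_sequence R M rs \<longleftrightarrow> set rs \<subseteq> carrier R \<and>
     (\<forall>i<length rs. nonzerodivisor_on
        (quotient_module M (ideal_smult R (Idl\<^bsub>R\<^esub> (set (take i rs))) M)) (rs ! i)) \<and>
     \<not> zero_module (quotient_module M (ideal_smult R (Idl\<^bsub>R\<^esub> (set rs)) M))"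

text \<open>
  Baer's criterion, by Zorn's lemma on the graphs of partial extensions: the lifting property of
  \<^const>\<open>injective_module\<close> does not depend on the type chosen for the test modules.
\<close>

definition linear_graph ::
    "('a, 'r) ring_scheme \<Rightarrow> ('a, 'b, 'm) module_scheme \<Rightarrow> ('a, 'c, 'n) module_scheme
      \<Rightarrow> ('b \<times> 'c) set \<Rightarrow> bool" where
  "linear_graph R B E G \<longleftrightarrow> G \<subseteq> carrier B \<times> carrier E \<and> (\<zero>\<^bsub>B\<^esub>, \<zero>\<^bsub>E\<^esub>) \<in> G \<and>
     (\<forall>x y x' y'. (x, y) \<in> G \<longrightarrow> (x', y') \<in> G \<longrightarrow> (x \<oplus>\<^bsub>B\<^esub> x', y \<oplus>\<^bsub>E\<^esub> y') \<in> G) \<and>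
     (\<forall>r\<in>carrier R. \<forall>x y. (x, y) \<in> G \<longrightarrow> (r \<odot>\<^bsub>B\<^esub> x, r \<odot>\<^bsub>E\<^esub> y) \<in> G) \<and>
     (\<forall>y. (\<zero>\<^bsub>B\<^esub>, y) \<in> G \<longrightarrow> y = \<zero>\<^bsub>E\<^esub>)"

lemma linear_graphD:
  assumes "linear_graph R B E G"
  shows "(x, y) \<in> G \<Longrightarrow> x \<in> carrier B" "(x, y) \<in> G \<Longrightarrow> y \<in> carrier E" "(\<zero>\<^bsub>B\<^esub>, \<zero>\<^bsub>E\<^esub>) \<in> G"
    "(x, y) \<in> G \<Longrightarrow> (x', y') \<in> G \<Longrightarrow> (x \<oplus>\<^bsub>B\<^esub> x', y \<oplus>\<^bsub>E\<^esub> y') \<in> G"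
    "r \<in> carrier R \<Longrightarrow> (x, y) \<in> G \<Longrightarrow> (r \<odot>\<^bsub>B\<^esub> x, r \<odot>\<^bsub>E\<^esub> y) \<in> G"
    "(\<zero>\<^bsub>B\<^esub>, y) \<in> G \<Longrightarrow> y = \<zero>\<^bsub>E\<^esub>"
  using assms unfolding linear_graph_def by blast+

lemma linear_graph_minus:
  assumes "module R B" "module R E" "linear_graph R B E G" "(x, y) \<in> G"
  shows "(\<ominus>\<^bsub>B\<^esub> x, \<ominus>\<^bsub>E\<^esub> y) \<in> G"
proof -
  interpret B: module R B by fact
  interpret E: module R E by fact
  have x: "x \<in> carrier B" and y: "y \<in> carrier E"
    using linear_graphD[OF assms(3)] assms(4) by blast+
  have "\<ominus>\<^bsub>R\<^esub> \<one>\<^bsub>R\<^esub> \<in> carrier R" by simp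
  then have "((\<ominus>\<^bsub>R\<^esub> \<one>\<^bsub>R\<^esub>) \<odot>\<^bsub>B\<^esub> x, (\<ominus>\<^bsub>R\<^esub> \<one>\<^bsub>R\<^esub>) \<odot>\<^bsub>E\<^esub> y) \<in> G"
    by (rule linear_graphD(5)[OF assms(3) _ assms(4)])
  then show ?thesis using x y by (simp add: B.smult_l_minus E.smult_l_minus)
qed

lemma linear_graph_functional:
  assumes "module R B" "module R E" "linear_graph R B E G" "(x, y) \<in> G" "(x, y') \<in> G"
  shows "y = y'"
proof -
  interpret B: module R B by fact
  interpret E: module R E by fact
  have x: "x \<in> carrier B" and y: "y \<in> carrier E" "y' \<in> carrier E"
    using linear_graphD[OF assms(3)] assms(4,5) by blast+
  have "(x \<oplus>\<^bsub>B\<^esub> (\<ominus>\<^bsub>B\<^esub> x), y \<oplus>\<^bsub>E\<^esub> (\<ominus>\<^bsub>E\<^esub> y')) \<in> G"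
    using linear_graphD(4)[OF assms(3,4) linear_graph_minus[OF assms(1-3,5)]] .
  then have "y \<oplus>\<^bsub>E\<^esub> (\<ominus>\<^bsub>E\<^esub> y') = \<zero>\<^bsub>E\<^esub>"
    using x linear_graphD(6)[OF assms(3)] by (simp add: B.M.r_neg)
  then show ?thesis using y E.M.minus_equality[of y "\<ominus>\<^bsub>E\<^esub> y'"] by simp
qed

lemma module_ring_module:
  assumes "cring R"
  shows "module R (ring_module R)"
proof -
  interpret cring R by fact
  have "abelian_group (ring_module R)"
  proof (rule abelian_groupI)
    fix x assume "x \<in> carrier (ring_module R)"
    then show "\<exists>y\<in>carrier (ring_module R). y \<oplus>\<^bsub>ring_module R\<^esub> x = \<zero>\<^bsub>ring_module R\<^esub>"
      by (auto simp: ring_module_def intro!: bexI[of _ "\<ominus>\<^bsub>R\<^esub> x"] l_neg)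
  qed (auto simp: ring_module_def a_ac)
  then show ?thesis
    by (intro moduleI) (auto simp: ring_module_def l_distr r_distr m_assoc assms)
qed

lemma injective_module_ideal:
  assumes "injective_module R E" "ideal \<aa> R" "cring R"
    and \<phi>: "\<phi> \<in> \<aa> \<rightarrow> carrier E" "\<And>r s. r \<in> \<aa> \<Longrightarrow> s \<in> \<aa> \<Longrightarrow> \<phi> (r \<oplus>\<^bsub>R\<^esub> s) = \<phi> r \<oplus>\<^bsub>E\<^esub> \<phi> s"
      "\<And>r s. r \<in> carrier R \<Longrightarrow> s \<in> \<aa> \<Longrightarrow> \<phi> (r \<otimes>\<^bsub>R\<^esub> s) = r \<odot>\<^bsub>E\<^esub> \<phi> s"
  shows "\<exists>e\<in>carrier E. \<forall>r\<in>\<aa>. \<phi> r = r \<odot>\<^bsub>E\<^esub> e"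
proof -
  interpret cring R by fact
  interpret \<aa>: ideal \<aa> R by fact
  let ?B = "ring_module R"
  let ?A = "?B\<lparr>carrier := \<aa>\<rparr>"
  have B: "module R ?B" by (rule module_ring_module) fact
  interpret B: module R ?B by fact
  have "submodule \<aa> R ?B"
  proof (intro B.submoduleI)
    fix a assume "a \<in> \<aa>"
    have "\<ominus>\<^bsub>?B\<^esub> a = \<ominus>\<^bsub>R\<^esub> a" by (simp add: a_inv_def m_inv_def ring_module_def)
    then show "\<ominus>\<^bsub>?B\<^esub> a \<in> \<aa>" using \<open>a \<in> \<aa>\<close> by simp
  qed (auto simp: ring_module_def \<aa>.I_l_closed)
  then have A: "module R ?A" by (rule submodule.submodule_is_module) fact
  have "id \<in> mod_hom R ?A ?B" by (auto simp: mod_hom_def ring_module_def)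
  moreover have "\<phi> \<in> mod_hom R ?A E"
    using \<phi> by (auto simp: mod_hom_def ring_module_def)
  moreover have "inj_on id (carrier ?A)" by simp
  ultimately obtain \<psi> where \<psi>: "\<psi> \<in> mod_hom R ?B E" "\<forall>x\<in>carrier ?A. \<psi> (id x) = \<phi> x"
    using assms(1) A B unfolding injective_module_def by blast
  have "\<phi> r = r \<odot>\<^bsub>E\<^esub> \<psi> \<one>\<^bsub>R\<^esub>" if "r \<in> \<aa>" for r
  proof -
    have r: "r \<in> carrier R" using that by simp
    have "\<phi> r = \<psi> (r \<otimes>\<^bsub>R\<^esub> \<one>\<^bsub>R\<^esub>)" using \<psi>(2) that r by simp
    also have "\<dots> = r \<odot>\<^bsub>E\<^esub> \<psi> \<one>\<^bsub>R\<^esub>"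
      using \<psi>(1) r by (auto simp: mod_hom_def ring_module_def simp del: r_one)
    finally show ?thesis .
  qed
  moreover have "\<psi> \<one>\<^bsub>R\<^esub> \<in> carrier E" using \<psi>(1) by (auto simp: mod_hom_def ring_module_def)
  ultimately show ?thesis by blast
qed

lemma linear_graph_extend:
  assumes E: "injective_module R E" and B: "module R B" and G: "linear_graph R B E G"
    and b: "b \<in> carrier B"
  shows "\<exists>G'. linear_graph R B E G' \<and> G \<subseteq> G' \<and> (\<exists>e. (b, e) \<in> G')"
proof -
  have E': "module R E" using E by (simp add: injective_module_def)
  interpret B: module R B by fact
  interpret E: module R E by fact
  note GD = linear_graphD[OF G]
  note sv = linear_graph_functional[OF B E' G]
  define \<aa> where "\<aa> = {r \<in> carrier R. \<exists>y. (r \<odot>\<^bsub>B\<^esub> b, y) \<in> G}"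
  define \<phi> where "\<phi> r = (THE y. (r \<odot>\<^bsub>B\<^esub> b, y) \<in> G)" for r
  have \<phi>_eq: "\<phi> r = y" if "(r \<odot>\<^bsub>B\<^esub> b, y) \<in> G" for r y
    unfolding \<phi>_def using that sv by blast
  have \<phi>_in: "(r \<odot>\<^bsub>B\<^esub> b, \<phi> r) \<in> G" if "r \<in> \<aa>" for r
    using that \<phi>_eq unfolding \<aa>_def by auto
  have add: "((r \<oplus>\<^bsub>R\<^esub> s) \<odot>\<^bsub>B\<^esub> b, \<phi> r \<oplus>\<^bsub>E\<^esub> \<phi> s) \<in> G" if "r \<in> \<aa>" "s \<in> \<aa>" for r s
    using GD(4)[OF \<phi>_in[OF that(1)] \<phi>_in[OF that(2)]] that b
    by (simp add: B.smult_l_distr \<aa>_def)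
  have mult: "((r \<otimes>\<^bsub>R\<^esub> s) \<odot>\<^bsub>B\<^esub> b, r \<odot>\<^bsub>E\<^esub> \<phi> s) \<in> G" if "r \<in> carrier R" "s \<in> \<aa>" for r s
    using GD(5)[OF that(1) \<phi>_in[OF that(2)]] that b
    by (simp add: B.smult_assoc1 \<aa>_def)
  have zero: "\<zero>\<^bsub>R\<^esub> \<in> \<aa>" using GD(3) b by (auto simp: \<aa>_def)
  have closed: "r \<oplus>\<^bsub>R\<^esub> s \<in> \<aa>" if "r \<in> \<aa>" "s \<in> \<aa>" for r s
    using add[OF that] that by (auto simp: \<aa>_def)
  have lclosed: "r \<otimes>\<^bsub>R\<^esub> s \<in> \<aa>" if "r \<in> carrier R" "s \<in> \<aa>" for r s
    using mult[OF that] that by (auto simp: \<aa>_def)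
  have minus: "\<ominus>\<^bsub>R\<^esub> r \<in> \<aa>" if "r \<in> \<aa>" for r
  proof -
    have "r \<in> carrier R" using that by (simp add: \<aa>_def)
    then have "\<ominus>\<^bsub>R\<^esub> r = (\<ominus>\<^bsub>R\<^esub> \<one>\<^bsub>R\<^esub>) \<otimes>\<^bsub>R\<^esub> r" by (simp add: B.R.l_minus)
    then show ?thesis using lclosed that by simp
  qed
  have id: "ideal \<aa> R"
  proof (rule idealI)
    show "ring R" by (rule B.R.ring_axioms)
    show "subgroup \<aa> (add_monoid R)"
      using zero closed minus
      by (intro B.R.add.subgroupI) (auto simp: \<aa>_def a_inv_def)
    show "x \<otimes>\<^bsub>R\<^esub> a \<in> \<aa>" if "a \<in> \<aa>" "x \<in> carrier R" for a x using lclosed that by blast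
    then show "a \<otimes>\<^bsub>R\<^esub> x \<in> \<aa>" if "a \<in> \<aa>" "x \<in> carrier R" for a x
      using that B.R.m_comm[of a x] by (simp add: \<aa>_def)
  qed
  have \<phi>1: "\<phi> \<in> \<aa> \<rightarrow> carrier E" using \<phi>_in GD(2) by blast
  have \<phi>2: "\<phi> (r \<oplus>\<^bsub>R\<^esub> s) = \<phi> r \<oplus>\<^bsub>E\<^esub> \<phi> s" if "r \<in> \<aa>" "s \<in> \<aa>" for r s
    using add[OF that] by (rule \<phi>_eq)
  have \<phi>3: "\<phi> (r \<otimes>\<^bsub>R\<^esub> s) = r \<odot>\<^bsub>E\<^esub> \<phi> s" if "r \<in> carrier R" "s \<in> \<aa>" for r s
    using mult[OF that] by (rule \<phi>_eq)
  have "\<exists>e\<in>carrier E. \<forall>r\<in>\<aa>. \<phi> r = r \<odot>\<^bsub>E\<^esub> e"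
    by (rule injective_module_ideal[OF E id B.R.is_cring \<phi>1 \<phi>2 \<phi>3])
  then obtain e where e: "e \<in> carrier E" "\<And>r. r \<in> \<aa> \<Longrightarrow> \<phi> r = r \<odot>\<^bsub>E\<^esub> e"
    by blast
  define G' where "G' = {(x \<oplus>\<^bsub>B\<^esub> r \<odot>\<^bsub>B\<^esub> b, y \<oplus>\<^bsub>E\<^esub> r \<odot>\<^bsub>E\<^esub> e) | x y r. (x, y) \<in> G \<and> r \<in> carrier R}"
  have "G \<subseteq> G'"
  proof (rule subrelI)
    fix x y assume xy: "(x, y) \<in> G"
    then have "x = x \<oplus>\<^bsub>B\<^esub> \<zero>\<^bsub>R\<^esub> \<odot>\<^bsub>B\<^esub> b" "y = y \<oplus>\<^bsub>E\<^esub> \<zero>\<^bsub>R\<^esub> \<odot>\<^bsub>E\<^esub> e" using GD(1,2) b e(1) by auto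
    then show "(x, y) \<in> G'" unfolding G'_def using xy B.R.zero_closed by blast
  qed
  moreover have "(b, e) \<in> G'"
  proof -
    have "b = \<zero>\<^bsub>B\<^esub> \<oplus>\<^bsub>B\<^esub> \<one>\<^bsub>R\<^esub> \<odot>\<^bsub>B\<^esub> b" "e = \<zero>\<^bsub>E\<^esub> \<oplus>\<^bsub>E\<^esub> \<one>\<^bsub>R\<^esub> \<odot>\<^bsub>E\<^esub> e" using b e(1) by auto
    then show ?thesis unfolding G'_def using GD(3) B.R.one_closed by blast
  qed
  moreover have "linear_graph R B E G'"
    unfolding linear_graph_def
  proof (intro conjI allI impI ballI)
    show "G' \<subseteq> carrier B \<times> carrier E" using GD(1,2) b e(1) by (auto simp: G'_def)
    show "(\<zero>\<^bsub>B\<^esub>, \<zero>\<^bsub>E\<^esub>) \<in> G'" using \<open>G \<subseteq> G'\<close> GD(3) by blast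
  next
    fix u v u' v' assume "(u, v) \<in> G'" "(u', v') \<in> G'"
    then obtain x y r x' y' r' where *: "u = x \<oplus>\<^bsub>B\<^esub> r \<odot>\<^bsub>B\<^esub> b" "v = y \<oplus>\<^bsub>E\<^esub> r \<odot>\<^bsub>E\<^esub> e"
      "u' = x' \<oplus>\<^bsub>B\<^esub> r' \<odot>\<^bsub>B\<^esub> b" "v' = y' \<oplus>\<^bsub>E\<^esub> r' \<odot>\<^bsub>E\<^esub> e"
      "(x, y) \<in> G" "(x', y') \<in> G" "r \<in> carrier R" "r' \<in> carrier R"
      unfolding G'_def by blast
    have c: "x \<in> carrier B" "x' \<in> carrier B" "y \<in> carrier E" "y' \<in> carrier E"
      using * GD(1,2) by blast+
    have "u \<oplus>\<^bsub>B\<^esub> u' = (x \<oplus>\<^bsub>B\<^esub> x') \<oplus>\<^bsub>B\<^esub> (r \<oplus>\<^bsub>R\<^esub> r') \<odot>\<^bsub>B\<^esub> b"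
      using * c b by (simp add: B.smult_l_distr B.M.a_ac)
    moreover have "v \<oplus>\<^bsub>E\<^esub> v' = (y \<oplus>\<^bsub>E\<^esub> y') \<oplus>\<^bsub>E\<^esub> (r \<oplus>\<^bsub>R\<^esub> r') \<odot>\<^bsub>E\<^esub> e"
      using * c e(1) by (simp add: E.smult_l_distr E.M.a_ac)
    moreover have "(x \<oplus>\<^bsub>B\<^esub> x', y \<oplus>\<^bsub>E\<^esub> y') \<in> G" using GD(4) * by blast
    ultimately show "(u \<oplus>\<^bsub>B\<^esub> u', v \<oplus>\<^bsub>E\<^esub> v') \<in> G'"
      unfolding G'_def using *(7,8) B.R.a_closed by blast
  next
    fix s u v assume s: "s \<in> carrier R" and "(u, v) \<in> G'"
    then obtain x y r where *: "u = x \<oplus>\<^bsub>B\<^esub> r \<odot>\<^bsub>B\<^esub> b" "v = y \<oplus>\<^bsub>E\<^esub> r \<odot>\<^bsub>E\<^esub> e"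
      "(x, y) \<in> G" "r \<in> carrier R"
      unfolding G'_def by blast
    have c: "x \<in> carrier B" "y \<in> carrier E" using * GD(1,2) by blast+
    have "s \<odot>\<^bsub>B\<^esub> u = s \<odot>\<^bsub>B\<^esub> x \<oplus>\<^bsub>B\<^esub> (s \<otimes>\<^bsub>R\<^esub> r) \<odot>\<^bsub>B\<^esub> b"
      using * c b s by (simp add: B.smult_r_distr B.smult_assoc1)
    moreover have "s \<odot>\<^bsub>E\<^esub> v = s \<odot>\<^bsub>E\<^esub> y \<oplus>\<^bsub>E\<^esub> (s \<otimes>\<^bsub>R\<^esub> r) \<odot>\<^bsub>E\<^esub> e"
      using * c e(1) s by (simp add: E.smult_r_distr E.smult_assoc1)
    moreover have "(s \<odot>\<^bsub>B\<^esub> x, s \<odot>\<^bsub>E\<^esub> y) \<in> G" using GD(5) s * by blast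
    ultimately show "(s \<odot>\<^bsub>B\<^esub> u, s \<odot>\<^bsub>E\<^esub> v) \<in> G'"
      unfolding G'_def using *(4) s B.R.m_closed by blast
  next
    fix v assume "(\<zero>\<^bsub>B\<^esub>, v) \<in> G'"
    then obtain x y r where *: "\<zero>\<^bsub>B\<^esub> = x \<oplus>\<^bsub>B\<^esub> r \<odot>\<^bsub>B\<^esub> b" "v = y \<oplus>\<^bsub>E\<^esub> r \<odot>\<^bsub>E\<^esub> e"
      "(x, y) \<in> G" "r \<in> carrier R"
      unfolding G'_def by blast
    have c: "x \<in> carrier B" "y \<in> carrier E" using * GD(1,2) by blast+
    have "r \<odot>\<^bsub>B\<^esub> b = \<ominus>\<^bsub>B\<^esub> x"
      using *(1,4) c b B.M.minus_equality[of "r \<odot>\<^bsub>B\<^esub> b" x] B.M.a_comm[of x "r \<odot>\<^bsub>B\<^esub> b"] by simp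
    then have m: "(r \<odot>\<^bsub>B\<^esub> b, \<ominus>\<^bsub>E\<^esub> y) \<in> G" using linear_graph_minus[OF B E' G *(3)] by simp
    then have "r \<in> \<aa>" using *(4) by (auto simp: \<aa>_def)
    then have "r \<odot>\<^bsub>E\<^esub> e = \<ominus>\<^bsub>E\<^esub> y" using e(2) \<phi>_eq[OF m] by simp
    then show "v = \<zero>\<^bsub>E\<^esub>" using *(2) c by (simp add: E.M.r_neg)
  qed
  ultimately show ?thesis by blast
qed

lemma injective_module_lift:
  fixes A :: "('a, 'c, 'm) module_scheme" and B :: "('a, 'd, 'n) module_scheme"
  assumes E: "injective_module R E" and A: "module R A" and B: "module R B"
    and i: "i \<in> mod_hom R A B" "inj_on i (carrier A)" and f: "f \<in> mod_hom R A E"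
  shows "\<exists>g\<in>mod_hom R B E. \<forall>x\<in>carrier A. g (i x) = f x"
proof -
  have E': "module R E" using E by (simp add: injective_module_def)
  interpret A: module R A by fact
  interpret B: module R B by fact
  interpret E: module R E by fact
  define G0 where "G0 = {(i x, f x) | x. x \<in> carrier A}"
  have ih: "i x \<in> carrier B" "f x \<in> carrier E" if "x \<in> carrier A" for x
    using i f that by (auto simp: mod_hom_def)
  have ia: "i x \<oplus>\<^bsub>B\<^esub> i y = i (x \<oplus>\<^bsub>A\<^esub> y)" "f x \<oplus>\<^bsub>E\<^esub> f y = f (x \<oplus>\<^bsub>A\<^esub> y)"
    if "x \<in> carrier A" "y \<in> carrier A" for x y
    using i f that by (auto simp: mod_hom_def)
  have sm: "r \<odot>\<^bsub>B\<^esub> i x = i (r \<odot>\<^bsub>A\<^esub> x)" "r \<odot>\<^bsub>E\<^esub> f x = f (r \<odot>\<^bsub>A\<^esub> x)"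
    if "x \<in> carrier A" "r \<in> carrier R" for x r
    using i f that by (auto simp: mod_hom_def)
  have z: "i \<zero>\<^bsub>A\<^esub> = \<zero>\<^bsub>B\<^esub>" "f \<zero>\<^bsub>A\<^esub> = \<zero>\<^bsub>E\<^esub>"
    using sm[of "\<zero>\<^bsub>A\<^esub>" "\<zero>\<^bsub>R\<^esub>"] ih[of "\<zero>\<^bsub>A\<^esub>"] by simp_all
  have G0: "linear_graph R B E G0"
    unfolding linear_graph_def
  proof (intro conjI allI impI ballI)
    show "G0 \<subseteq> carrier B \<times> carrier E" using ih by (auto simp: G0_def)
    show "(\<zero>\<^bsub>B\<^esub>, \<zero>\<^bsub>E\<^esub>) \<in> G0" unfolding G0_def using z A.M.zero_closed by force
    show "(x \<oplus>\<^bsub>B\<^esub> x', y \<oplus>\<^bsub>E\<^esub> y') \<in> G0" if "(x, y) \<in> G0" "(x', y') \<in> G0" for x y x' y'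
      using that ia A.M.add.m_closed unfolding G0_def by force
    show "(r \<odot>\<^bsub>B\<^esub> x, r \<odot>\<^bsub>E\<^esub> y) \<in> G0" if "r \<in> carrier R" "(x, y) \<in> G0" for r x y
      using that sm A.smult_closed unfolding G0_def by force
    show "y = \<zero>\<^bsub>E\<^esub>" if "(\<zero>\<^bsub>B\<^esub>, y) \<in> G0" for y
    proof -
      obtain x where x: "x \<in> carrier A" "i x = \<zero>\<^bsub>B\<^esub>" "y = f x" using \<open>(\<zero>\<^bsub>B\<^esub>, y) \<in> G0\<close> by (auto simp: G0_def)
      then have "x = \<zero>\<^bsub>A\<^esub>" using i(2) z(1) A.M.zero_closed by (metis inj_onD)
      then show ?thesis using x z by simp
    qed
  qed
  define \<G> where "\<G> = {G. linear_graph R B E G \<and> G0 \<subseteq> G}"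
  have "\<exists>G\<in>\<G>. \<forall>G'\<in>\<G>. G \<subseteq> G' \<longrightarrow> G' = G"
  proof (rule subset_Zorn_nonempty)
    show "\<G> \<noteq> {}" using G0 by (auto simp: \<G>_def)
    fix \<C> assume ne: "\<C> \<noteq> {}" and ch: "subset.chain \<G> \<C>"
    have lin: "linear_graph R B E G" "G0 \<subseteq> G" if "G \<in> \<C>" for G
      using ch that by (auto simp: subset_chain_def \<G>_def)
    have "linear_graph R B E (\<Union>\<C>)"
      unfolding linear_graph_def
    proof (intro conjI allI impI ballI)
      show "\<Union>\<C> \<subseteq> carrier B \<times> carrier E" using lin(1) unfolding linear_graph_def by blast
      show "(\<zero>\<^bsub>B\<^esub>, \<zero>\<^bsub>E\<^esub>) \<in> \<Union>\<C>" using ne linear_graphD(3)[OF lin(1)] by blast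
      show "(x \<oplus>\<^bsub>B\<^esub> x', y \<oplus>\<^bsub>E\<^esub> y') \<in> \<Union>\<C>" if xy: "(x, y) \<in> \<Union>\<C>" "(x', y') \<in> \<Union>\<C>" for x y x' y'
      proof -
        obtain G G' where G: "G \<in> \<C>" "G' \<in> \<C>" "(x, y) \<in> G" "(x', y') \<in> G'" using xy by blast
        then have "G \<subseteq> G' \<or> G' \<subseteq> G" using ch by (auto simp: subset_chain_def)
        then obtain K where "K \<in> \<C>" "(x, y) \<in> K" "(x', y') \<in> K" using G by blast
        then show ?thesis using linear_graphD(4)[OF lin(1)] by blast
      qed
      show "(r \<odot>\<^bsub>B\<^esub> x, r \<odot>\<^bsub>E\<^esub> y) \<in> \<Union>\<C>" if "r \<in> carrier R" "(x, y) \<in> \<Union>\<C>" for r x y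
        using that linear_graphD(5)[OF lin(1)] by blast
      show "y = \<zero>\<^bsub>E\<^esub>" if "(\<zero>\<^bsub>B\<^esub>, y) \<in> \<Union>\<C>" for y
        using that linear_graphD(6)[OF lin(1)] by blast
    qed
    then show "\<Union>\<C> \<in> \<G>" using ne lin(2) by (auto simp: \<G>_def)
  qed
  then obtain G where "G \<in> \<G>" and max': "\<forall>G'\<in>\<G>. G \<subseteq> G' \<longrightarrow> G' = G" by blast
  then have G: "linear_graph R B E G" "G0 \<subseteq> G" by (simp_all add: \<G>_def)
  have max: "G' = G" if "linear_graph R B E G'" "G \<subseteq> G'" for G'
    using max' that G(2) by (auto simp: \<G>_def)
  have total: "\<exists>y. (x, y) \<in> G" if x: "x \<in> carrier B" for x
  proof -
    obtain G' y where "linear_graph R B E G'" "G \<subseteq> G'" "(x, y) \<in> G'"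
      using linear_graph_extend[OF E B G(1) x] by auto
    then show ?thesis using max by auto
  qed
  define g where "g x = (SOME y. (x, y) \<in> G)" for x
  have g_in: "(x, g x) \<in> G" if "x \<in> carrier B" for x
    unfolding g_def using total[OF that] by (rule someI_ex)
  have g_eq: "g x = y" if "(x, y) \<in> G" for x y
    using g_in[OF linear_graphD(1)[OF G(1) that]] linear_graph_functional[OF B E' G(1)] that by blast
  have "g \<in> mod_hom R B E"
    unfolding mod_hom_def
    using g_in linear_graphD[OF G(1)] by (auto intro!: g_eq intro: linear_graphD(2)[OF G(1) g_in])
  moreover have "g (i x) = f x" if "x \<in> carrier A" for x
    using that G(2) by (intro g_eq) (auto simp: G0_def)
  ultimately show ?thesis by blast
qed

end

theory Submission
  imports Defs
begin

text \<open>
  Put \<open>H = H\<^sup>h\<^sub>I(R)\<close> and \<open>D = Hom(H, E)\<close>. Since \<open>E\<close> is an injective cogenerator,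
  \<open>D / (r\<^sub>1, \<dots>, r\<^sub>i) D\<close> is the dual of the annihilator \<open>H\<^sub>i\<close> of \<open>(r\<^sub>1, \<dots>, r\<^sub>i)\<close> in \<open>H\<close>, so
  \<open>r\<^sub>1, \<dots>, r\<^sub>n\<close> is \<open>D\<close>-regular iff each \<open>r\<close> at position \<open>i + 1\<close> maps \<open>H\<^sub>i\<close> onto itself and
  \<open>H\<^sub>n \<noteq> 0\<close>. Every element of \<open>H\<close> is killed by a power of each element of \<open>I\<close>, and this alone makes
  such sequences in \<open>I\<close> permutable. Consequently no member of the sequence lies in the ideal of the
  others: otherwise, moved to the end, it would act on the preceding annihilator both as zero and
  surjectively, forcing \<open>H\<^sub>n = 0\<close>. Over a local ring this permits a Steinitz exchange: each
  \<open>r\<^sub>i\<close> can be replaced by some \<open>r'\<^sub>j\<close> in which it occurs with a unit coefficient, until the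
  sequence is a permutation of \<open>r'\<^sub>1, \<dots>, r'\<^sub>n\<close>.
\<close>

section \<open>Coregular sequences on torsion modules\<close>

text \<open>The colon submodule \<open>0 : S\<close> of \<open>M\<close>, a copy of Hom(R/(S), M)
  made of elements of \<open>M\<close> itself.\<close>

definition annihilated :: "('a, 'b, 'm) module_scheme \<Rightarrow> 'a set \<Rightarrow> 'b set" where
  "annihilated M S = {x \<in> carrier M. \<forall>s\<in>S. s \<odot>\<^bsub>M\<^esub> x = \<zero>\<^bsub>M\<^esub>}"

definition acts_onto :: "('a, 'b, 'm) module_scheme \<Rightarrow> 'a \<Rightarrow> 'a set \<Rightarrow> bool" where
  "acts_onto M r S \<longleftrightarrow> (\<forall>x\<in>annihilated M S. \<exists>y\<in>annihilated M S. r \<odot>\<^bsub>M\<^esub> y = x)"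

text \<open>The dual of weak regularity: surjectivity on successive annihilated submodules replaces
  injectivity on successive quotients. Nonvanishing of the last submodule is kept apart, since it
  depends only on the ideal generated by the entries.\<close>

definition coregular :: "('a, 'b, 'm) module_scheme \<Rightarrow> 'a list \<Rightarrow> bool" where
  "coregular M rs \<longleftrightarrow> (\<forall>i<length rs. acts_onto M (rs ! i) (set (take i rs)))"

lemma coregular_Nil [simp]: "coregular M []"
  by (simp add: coregular_def)

text \<open>Splitting off the last entry leaves the prefixes of the other entries unchanged; hence
  the inductions from the right below.\<close>

lemma coregular_snoc [simp]:
  "coregular M (rs @ [r]) \<longleftrightarrow> coregular M rs \<and> acts_onto M r (set rs)"
  by (auto simp: coregular_def nth_append less_Suc_eq)

text \<open>Only powers of single elements of \<open>I\<close> are asked to kill \<open>x\<close>,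
  with an exponent depending on the element and on \<open>x\<close>; this is the form in which the
  swap of neighbours uses torsion.\<close>

definition torsion_on :: "('a, 'r) ring_scheme \<Rightarrow> 'a set \<Rightarrow> ('a, 'b, 'm) module_scheme \<Rightarrow> bool" where
  "torsion_on R I M \<longleftrightarrow> (\<forall>r\<in>I. \<forall>x\<in>carrier M. \<exists>n::nat. (r [^]\<^bsub>R\<^esub> n) \<odot>\<^bsub>M\<^esub> x = \<zero>\<^bsub>M\<^esub>)"

context module
begin

lemma smult_minus_eq_zero:
  assumes "a \<in> carrier R" "x \<in> carrier M" "y \<in> carrier M" "a \<odot>\<^bsub>M\<^esub> x = a \<odot>\<^bsub>M\<^esub> y"
  shows "a \<odot>\<^bsub>M\<^esub> (x \<ominus>\<^bsub>M\<^esub> y) = \<zero>\<^bsub>M\<^esub>"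
  using assms by (simp add: M.minus_eq smult_r_distr smult_r_minus M.r_neg)

lemma smult_comm:
  assumes "a \<in> carrier R" "b \<in> carrier R" "x \<in> carrier M"
  shows "a \<odot>\<^bsub>M\<^esub> (b \<odot>\<^bsub>M\<^esub> x) = b \<odot>\<^bsub>M\<^esub> (a \<odot>\<^bsub>M\<^esub> x)"
  using assms by (metis R.m_comm smult_assoc1)

lemma annihilated_submodule:
  assumes "S \<subseteq> carrier R"
  shows "submodule (annihilated M S) R M"
proof (rule submoduleI)
  show "r \<odot>\<^bsub>M\<^esub> x \<in> annihilated M S" if "r \<in> carrier R" "x \<in> annihilated M S" for r x
    using that assms smult_comm[of _ r x] by (auto simp: annihilated_def subset_iff)
qed (use assms in \<open>auto simp: annihilated_def subset_iff smult_r_distr smult_r_minus\<close>)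

lemma zero_in_annihilated: "S \<subseteq> carrier R \<Longrightarrow> \<zero>\<^bsub>M\<^esub> \<in> annihilated M S"
  by (auto simp: annihilated_def)

lemma annihilator_ideal:
  assumes "T \<subseteq> carrier M"
  shows "ideal {r \<in> carrier R. \<forall>x\<in>T. r \<odot>\<^bsub>M\<^esub> x = \<zero>\<^bsub>M\<^esub>} R" (is "ideal ?A R")
proof (rule idealI)
  show "subgroup ?A (add_monoid R)"
  proof (rule R.add.subgroupI)
    show "\<ominus> a \<in> ?A" if "a \<in> ?A" for a
      using that assms smult_l_minus[of a] by (auto simp: subset_iff)
  qed (use assms in \<open>auto simp: subset_iff smult_l_distr\<close>)
  show r: "x \<otimes> a \<in> ?A" if "a \<in> ?A" "x \<in> carrier R" for a x
    using that assms by (auto simp: subset_iff smult_assoc1)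
  show "a \<otimes> x \<in> ?A" if "a \<in> ?A" "x \<in> carrier R" for a x
    using r[OF that] that by (simp add: R.m_comm)
qed (rule R.ring_axioms)

text \<open>The scalars killing \<open>annihilated M S\<close> form an ideal that contains
  \<open>S\<close>, hence also \<open>Idl S\<close>. Thus the annihilated submodule is an invariant
  of the generated ideal.\<close>

lemma annihilated_genideal:
  assumes "S \<subseteq> carrier R"
  shows "annihilated M (Idl S) = annihilated M S"
proof
  show "annihilated M (Idl S) \<subseteq> annihilated M S"
    using R.genideal_self[OF assms] by (auto simp: annihilated_def)
  let ?A = "{r \<in> carrier R. \<forall>x\<in>annihilated M S. r \<odot>\<^bsub>M\<^esub> x = \<zero>\<^bsub>M\<^esub>}"
  have "Idl S \<subseteq> ?A"
    using assms by (intro R.genideal_minimal annihilator_ideal) (auto simp: annihilated_def)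
  then show "annihilated M S \<subseteq> annihilated M (Idl S)"
    by (auto simp: annihilated_def subset_iff)
qed

text \<open>This dualizes the exchange of neighbours in a regular sequence, with torsion for
  \<open>a\<close> in the place of Nakayama's lemma. Let \<open>?N\<close> be the submodule killed
  by \<open>S\<close>. Surjectivity of \<open>b\<close> spreads from the kernel of \<open>a\<close>
  on \<open>?N\<close> to the kernels of all powers of \<open>a\<close>, which exhaust
  \<open>?N\<close>; then a preimage under \<open>a\<close> is corrected by an element of the kernel
  of \<open>a\<close>.\<close>

lemma acts_onto_swap:
  assumes S: "S \<subseteq> carrier R" and ab: "a \<in> carrier R" "b \<in> carrier R"
    and tor: "\<And>x. x \<in> carrier M \<Longrightarrow> \<exists>n::nat. (a [^] n) \<odot>\<^bsub>M\<^esub> x = \<zero>\<^bsub>M\<^esub>"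
    and a: "acts_onto M a S" and b: "acts_onto M b (insert a S)"
  shows "acts_onto M b S" "acts_onto M a (insert b S)"
proof -
  let ?N = "annihilated M S"
  interpret N: submodule ?N R M by (rule annihilated_submodule[OF S])
  have N_ins: "x \<in> annihilated M (insert r S) \<longleftrightarrow> x \<in> ?N \<and> r \<odot>\<^bsub>M\<^esub> x = \<zero>\<^bsub>M\<^esub>" for r x
    by (auto simp: annihilated_def)
  have N_car: "x \<in> carrier M" if "x \<in> ?N" for x using that by (simp add: annihilated_def)
  note N_minus = submoduleE(5)[OF annihilated_submodule[OF S]] submoduleE(3)[OF annihilated_submodule[OF S]]
  have N_diff: "x \<ominus>\<^bsub>M\<^esub> y \<in> ?N" if "x \<in> ?N" "y \<in> ?N" for x y
    using N_minus that by (simp add: M.minus_eq)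
  have pow: "\<exists>z\<in>?N. (a [^] (n::nat)) \<odot>\<^bsub>M\<^esub> z = y" if "y \<in> ?N" for n y
    using that
  proof (induction n arbitrary: y)
    case 0 then show ?case using N_car by auto
  next
    case (Suc n)
    obtain w where w: "w \<in> ?N" "a \<odot>\<^bsub>M\<^esub> w = y" using a Suc.prems by (auto simp: acts_onto_def)
    obtain z where z: "z \<in> ?N" "(a [^] n) \<odot>\<^bsub>M\<^esub> z = w" using Suc.IH[OF w(1)] by blast
    have "(a [^] Suc n) \<odot>\<^bsub>M\<^esub> z = a \<odot>\<^bsub>M\<^esub> ((a [^] n) \<odot>\<^bsub>M\<^esub> z)"
      using ab z(1) N_car by (simp add: smult_assoc1 smult_comm)
    then show ?case using z w by auto
  qed
  \<comment> \<open>With \<open>y\<close> in the kernel of \<open>a\<close> such that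
    \<open>b y = a^n x\<close>, and \<open>y = a^n z\<close> by \<open>pow\<close>, the difference
    \<open>x - b z\<close> is killed by \<open>a^n\<close>, so the induction hypothesis applies to
    it.\<close>
  have b_onto: "\<exists>y\<in>?N. b \<odot>\<^bsub>M\<^esub> y = x" if "x \<in> ?N" "(a [^] (n::nat)) \<odot>\<^bsub>M\<^esub> x = \<zero>\<^bsub>M\<^esub>" for n x
    using that
  proof (induction n arbitrary: x)
    case 0
    then show ?case using ab N_car zero_in_annihilated[OF S] by (intro bexI[of _ "\<zero>\<^bsub>M\<^esub>"]) auto
  next
    case (Suc n)
    have x: "x \<in> carrier M" using Suc.prems N_car by blast
    let ?u = "(a [^] n) \<odot>\<^bsub>M\<^esub> x"
    have "?u \<in> annihilated M (insert a S)"
      using Suc.prems ab x by (simp add: N_ins smult_assoc1 smult_comm)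
    then obtain y where "y \<in> annihilated M (insert a S)" "b \<odot>\<^bsub>M\<^esub> y = ?u"
      using b unfolding acts_onto_def by blast
    then have y: "y \<in> ?N" "a \<odot>\<^bsub>M\<^esub> y = \<zero>\<^bsub>M\<^esub>" "b \<odot>\<^bsub>M\<^esub> y = ?u" by (simp_all add: N_ins)
    obtain z where z: "z \<in> ?N" "(a [^] n) \<odot>\<^bsub>M\<^esub> z = y" using pow y(1) by blast
    have bz: "b \<odot>\<^bsub>M\<^esub> z \<in> ?N" using z ab by blast
    have "(a [^] n) \<odot>\<^bsub>M\<^esub> (b \<odot>\<^bsub>M\<^esub> z) = ?u"
      using z y ab N_car smult_comm[of "a [^] n" b z] by simp
    then have "(a [^] n) \<odot>\<^bsub>M\<^esub> (x \<ominus>\<^bsub>M\<^esub> b \<odot>\<^bsub>M\<^esub> z) = \<zero>\<^bsub>M\<^esub>"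
      using ab x bz N_car by (intro smult_minus_eq_zero) auto
    from Suc.IH[OF N_diff[OF Suc.prems(1) bz] this]
    obtain w where w: "w \<in> ?N" "b \<odot>\<^bsub>M\<^esub> w = x \<ominus>\<^bsub>M\<^esub> b \<odot>\<^bsub>M\<^esub> z" by blast
    have "b \<odot>\<^bsub>M\<^esub> (w \<oplus>\<^bsub>M\<^esub> z) = x"
      using w z x bz ab N_car by (simp add: smult_r_distr M.minus_eq M.a_assoc M.l_neg)
    then show ?case using N_minus(1)[OF w(1) z(1)] by blast
  qed
  show "acts_onto M b S"
    unfolding acts_onto_def
  proof
    fix x assume x: "x \<in> ?N"
    then obtain n :: nat where "(a [^] n) \<odot>\<^bsub>M\<^esub> x = \<zero>\<^bsub>M\<^esub>" using tor N_car by blast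
    with x show "\<exists>y\<in>?N. b \<odot>\<^bsub>M\<^esub> y = x" by (rule b_onto)
  qed
  show "acts_onto M a (insert b S)"
    unfolding acts_onto_def
  proof
    fix x assume "x \<in> annihilated M (insert b S)"
    then have x: "x \<in> ?N" "b \<odot>\<^bsub>M\<^esub> x = \<zero>\<^bsub>M\<^esub>" by (simp_all add: N_ins)
    obtain y where y: "y \<in> ?N" "a \<odot>\<^bsub>M\<^esub> y = x" using a x by (auto simp: acts_onto_def)
    \<comment> \<open>The preimage \<open>y\<close> of \<open>x\<close> under \<open>a\<close> need
      not be killed by \<open>b\<close>, but \<open>b y\<close> lies in the kernel of
      \<open>a\<close>, so it equals \<open>b w\<close> for some \<open>w\<close> of that kernel;
      then \<open>y - w\<close> is killed by \<open>b\<close> and still maps to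
      \<open>x\<close>.\<close>
    have "a \<odot>\<^bsub>M\<^esub> (b \<odot>\<^bsub>M\<^esub> y) = \<zero>\<^bsub>M\<^esub>" using smult_comm[of a b y] y x ab N_car by simp
    then have "b \<odot>\<^bsub>M\<^esub> y \<in> annihilated M (insert a S)" using y ab by (auto simp: N_ins)
    then obtain w where "w \<in> annihilated M (insert a S)" "b \<odot>\<^bsub>M\<^esub> w = b \<odot>\<^bsub>M\<^esub> y"
      using b unfolding acts_onto_def by blast
    then have w: "w \<in> ?N" "a \<odot>\<^bsub>M\<^esub> w = \<zero>\<^bsub>M\<^esub>" "b \<odot>\<^bsub>M\<^esub> w = b \<odot>\<^bsub>M\<^esub> y"
      by (simp_all add: N_ins)
    have "b \<odot>\<^bsub>M\<^esub> (y \<ominus>\<^bsub>M\<^esub> w) = \<zero>\<^bsub>M\<^esub>" using w y ab N_car by (intro smult_minus_eq_zero) auto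
    moreover have "a \<odot>\<^bsub>M\<^esub> (y \<ominus>\<^bsub>M\<^esub> w) = x"
      using w y ab N_car x(1) by (simp add: M.minus_eq smult_r_distr smult_r_minus)
    ultimately show "\<exists>y\<in>annihilated M (insert b S). a \<odot>\<^bsub>M\<^esub> y = x"
      using N_diff[OF y(1) w(1)] by (auto simp: N_ins)
  qed
qed

text \<open>\<open>a\<close> is carried past the entries of \<open>q\<close> one at a time. The two
  conclusions of \<open>acts_onto_swap\<close> serve the two halves of the claim: the passed entry
  acts onto without \<open>a\<close> before it, and \<open>a\<close> acts onto after it.\<close>

lemma coregular_move_last:
  assumes "coregular M (p @ a # q)" "set (p @ a # q) \<subseteq> I" "I \<subseteq> carrier R" "torsion_on R I M"
  shows "coregular M (p @ q) \<and> acts_onto M a (set (p @ q))"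
  using assms(1,2)
proof (induction q rule: rev_induct)
  case Nil then show ?case by simp
next
  case (snoc b q)
  have "coregular M ((p @ a # q) @ [b])" using snoc.prems(1) by simp
  then have *: "coregular M (p @ a # q)" "acts_onto M b (insert a (set (p @ q)))"
    unfolding coregular_snoc by simp_all
  then have IH: "coregular M (p @ q)" "acts_onto M a (set (p @ q))"
    using snoc.IH snoc.prems(2) by simp_all
  have "acts_onto M b (set (p @ q))" "acts_onto M a (insert b (set (p @ q)))"
    using acts_onto_swap[OF _ _ _ _ IH(2) *(2)] snoc.prems(2) assms(3,4)
    by (simp_all add: torsion_on_def subset_iff)
  then have "coregular M ((p @ q) @ [b])" "acts_onto M a (set ((p @ q) @ [b]))"
    using IH(1) unfolding coregular_snoc by simp_all
  then show ?case by simp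
qed

text \<open>Induction on the target list: its last entry is moved to the end of \<open>rs\<close>,
  and the remaining entries are rearranged by the induction hypothesis.\<close>

lemma coregular_mset:
  assumes "coregular M rs" "mset rs = mset rs'" "set rs \<subseteq> I" "I \<subseteq> carrier R" "torsion_on R I M"
  shows "coregular M rs'"
  using assms(1-3)
proof (induction rs' arbitrary: rs rule: rev_induct)
  case Nil then show ?case by simp
next
  case (snoc y ys)
  have "y \<in> set rs" using mset_eq_setD[OF snoc.prems(2)] by simp
  then obtain p q where rs: "rs = p @ y # q" by (meson split_list)
  then have m: "mset (p @ q) = mset ys" using snoc.prems(2) by simp
  have "coregular M (p @ q)" "acts_onto M y (set (p @ q))"
    using coregular_move_last[of p y q] snoc.prems assms(4,5) rs by blast+
  moreover have "set (p @ q) = set ys" using mset_eq_setD[OF m] .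
  ultimately show ?case using snoc.IH[OF _ m] snoc.prems(3) rs by simp
qed

lemma coregular_notin_genideal:
  assumes "coregular M (p @ [s])" "set (p @ [s]) \<subseteq> carrier R"
    and "annihilated M (set (p @ [s])) \<noteq> {\<zero>\<^bsub>M\<^esub>}"
  shows "s \<notin> Idl (set p)"
proof
  assume s: "s \<in> Idl (set p)"
  have p: "set p \<subseteq> carrier R" using assms(2) by simp
  have kill: "s \<odot>\<^bsub>M\<^esub> y = \<zero>\<^bsub>M\<^esub>" if "y \<in> annihilated M (set p)" for y
    using that s annihilated_genideal[OF p] by (auto simp: annihilated_def)
  have "x = \<zero>\<^bsub>M\<^esub>" if "x \<in> annihilated M (set (p @ [s]))" for x
  proof -
    have "x \<in> annihilated M (set p)" using that by (auto simp: annihilated_def)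
    then show ?thesis using assms(1) kill unfolding coregular_snoc acts_onto_def by metis
  qed
  then show False using assms(3) zero_in_annihilated[OF assms(2)] by blast
qed

end

section \<open>Ideals and units in noetherian local rings\<close>

text \<open>Serves twice: with \<open>\<bb>\<close> the whole ring it bounds the ideal generated by
  one further element, and with \<open>\<bb> = \<mm>\<close> it collects the elements having a
  nonunit coefficient at \<open>s\<close>.\<close>

lemma (in cring) ideal_add_multiples:
  assumes "ideal \<aa> R" "ideal \<bb> R" "s \<in> carrier R"
  shows "ideal {y \<oplus> c \<otimes> s | y c. y \<in> \<aa> \<and> c \<in> \<bb>} R" (is "ideal ?B R")
proof -
  interpret \<aa>: ideal \<aa> R by fact
  interpret \<bb>: ideal \<bb> R by fact
  show ?thesis
  proof (rule idealI)
    show "ring R" by (rule ring_axioms)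
    show l: "x \<otimes> a \<in> ?B" if ax: "a \<in> ?B" "x \<in> carrier R" for a x
    proof -
      obtain y c where yc: "a = y \<oplus> c \<otimes> s" "y \<in> \<aa>" "c \<in> \<bb>" using ax(1) by blast
      then have "x \<otimes> a = x \<otimes> y \<oplus> (x \<otimes> c) \<otimes> s"
        using ax(2) assms(3) by (simp add: r_distr m_assoc)
      then show ?thesis using yc ax(2) \<aa>.I_l_closed \<bb>.I_l_closed by blast
    qed
    have car: "?B \<subseteq> carrier R" using assms(3) by auto
    show "a \<otimes> x \<in> ?B" if "a \<in> ?B" "x \<in> carrier R" for a x
      using l[OF that] unfolding m_comm[OF subsetD[OF car that(1)] that(2)] .
    show "subgroup ?B (add_monoid R)"
    proof (rule add.subgroupI)
      show "?B \<subseteq> carrier R" by (rule car)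
      have "\<zero> \<oplus> \<zero> \<otimes> s \<in> ?B" using \<aa>.zero_closed \<bb>.zero_closed by blast
      then show "?B \<noteq> {}" by (metis empty_iff)
      show "\<ominus> a \<in> ?B" if "a \<in> ?B" for a
      proof -
        have "a \<in> carrier R" by (rule subsetD[OF car that])
        then have "\<ominus> a = (\<ominus> \<one>) \<otimes> a" by (simp add: l_minus)
        then show ?thesis using l[OF that, of "\<ominus> \<one>"] by simp
      qed
      show "a \<oplus> b \<in> ?B" if ab: "a \<in> ?B" "b \<in> ?B" for a b
      proof -
        obtain y c y' c' where yc: "a = y \<oplus> c \<otimes> s" "b = y' \<oplus> c' \<otimes> s"
          "y \<in> \<aa>" "c \<in> \<bb>" "y' \<in> \<aa>" "c' \<in> \<bb>" using ab by blast
        then have "a \<oplus> b = (y \<oplus> y') \<oplus> (c \<oplus> c') \<otimes> s"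
          using assms(3) by (simp add: l_distr a_ac)
        then show ?thesis using yc \<aa>.a_closed \<bb>.a_closed by blast
      qed
    qed
  qed
qed

lemma (in cring) genideal_insert_subset:
  assumes "ideal \<aa> R" "S \<subseteq> \<aa>" "s \<in> carrier R"
  shows "Idl (insert s S) \<subseteq> {y \<oplus> c \<otimes> s | y c. y \<in> \<aa> \<and> c \<in> carrier R}" (is "_ \<subseteq> ?B")
proof (rule genideal_minimal)
  interpret \<aa>: ideal \<aa> R by fact
  show "ideal ?B R" by (rule ideal_add_multiples[OF assms(1) oneideal assms(3)])
  have "s = \<zero> \<oplus> \<one> \<otimes> s" using assms(3) by simp
  moreover have "x = x \<oplus> \<zero> \<otimes> s" if "x \<in> S" for x using that assms(2,3) by auto
  ultimately show "insert s S \<subseteq> ?B" using assms(2) \<aa>.zero_closed by blast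
qed

lemma (in noetherian_ring) ideal_subset_maximalideal:
  assumes "ideal \<aa> R" "\<aa> \<noteq> carrier R"
  shows "\<exists>\<nn>. maximalideal \<nn> R \<and> \<aa> \<subseteq> \<nn>"
proof -
  let ?S = "{J. ideal J R \<and> \<aa> \<subseteq> J \<and> \<one> \<notin> J}"
  have "\<exists>N\<in>?S. \<forall>J\<in>?S. N \<subseteq> J \<longrightarrow> J = N"
  proof (rule subset_Zorn_nonempty)
    show "?S \<noteq> {}" using assms ideal.one_imp_carrier by blast
    fix C assume C: "C \<noteq> {}" "subset.chain ?S C"
    \<comment> \<open>In a noetherian ring a nonempty chain of ideals contains its own union, so the
      union is proper as well.\<close>
    then have "\<Union>C \<in> C" by (intro ideal_chain_is_trivial) (auto simp: subset_chain_def)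
    then show "\<Union>C \<in> ?S" using C(2) unfolding subset_chain_def by blast
  qed
  then obtain N where N: "ideal N R" "\<aa> \<subseteq> N" "\<one> \<notin> N"
    and max: "\<And>J. ideal J R \<Longrightarrow> \<aa> \<subseteq> J \<Longrightarrow> \<one> \<notin> J \<Longrightarrow> N \<subseteq> J \<Longrightarrow> J = N" by auto
  have "maximalideal N R"
  proof (rule maximalidealI[OF N(1)])
    show "carrier R \<noteq> N" using N(3) by blast
    show "J = N \<or> J = carrier R" if "ideal J R" "N \<subseteq> J" "J \<subseteq> carrier R" for J
      using max[OF that(1)] that N(2) ideal.one_imp_carrier[OF that(1)] by blast
  qed
  then show ?thesis using N(2) by blast
qed

context noetherian_local_ring
begin

text \<open>A nonunit generates a proper ideal; this lies in some maximal ideal, and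
  \<open>\<mm>\<close> is the only one.\<close>

lemma nonunit_in_maximal:
  assumes "c \<in> carrier R" "c \<notin> Units R"
  shows "c \<in> \<mm>"
proof -
  have "\<one> \<notin> PIdl c"
  proof
    assume "\<one> \<in> PIdl c"
    then obtain x where "x \<in> carrier R" "\<one> = x \<otimes> c" by (auto simp: cgenideal_def)
    then show False using assms m_comm[of x c] by (auto simp: Units_def)
  qed
  then have "PIdl c \<noteq> carrier R" by auto
  then obtain \<nn> where \<nn>: "maximalideal \<nn> R" "PIdl c \<subseteq> \<nn>"
    using ideal_subset_maximalideal[OF cgenideal_ideal[OF assms(1)]] by blast
  then show ?thesis using cgenideal_self[OF assms(1)] maximal_unique[OF \<nn>(1)] by blast
qed

lemma one_notin_maximal: "\<one> \<notin> \<mm>"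
  using one_imp_carrier I_notcarr by blast

text \<open>Otherwise \<open>\<one> = (\<one> \<ominus> c) \<oplus> c\<close> would lie in
  \<open>\<mm>\<close>.\<close>

lemma one_minus_maximal_Units:
  assumes "c \<in> \<mm>"
  shows "\<one> \<ominus> c \<in> Units R"
proof (rule ccontr)
  have c: "c \<in> carrier R" using assms by simp
  assume "\<one> \<ominus> c \<notin> Units R"
  then have "\<one> \<ominus> c \<in> \<mm>" using nonunit_in_maximal c by simp
  then have "(\<one> \<ominus> c) \<oplus> c \<in> \<mm>" using assms by (rule a_closed)
  then show False using one_notin_maximal c by (simp add: minus_eq a_assoc l_neg)
qed

text \<open>
  If the coefficient of \<open>s\<close> lay in \<open>\<mm>\<close> for every member of \<open>U\<close>, then \<open>s = y + c s\<close> with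
  \<open>c \<in> \<mm>\<close> and \<open>y \<in> (p)\<close>, whence \<open>s \<in> (p)\<close> because \<open>1 - c\<close> is a unit.
\<close>

lemma exchange_generator:
  assumes p: "set p \<subseteq> carrier R" and s: "s \<in> carrier R" "s \<notin> Idl (set p)"
    and U: "U \<subseteq> carrier R" "Idl U = Idl (set (p @ [s]))"
  shows "\<exists>u\<in>U. \<exists>y\<in>Idl (set p). \<exists>c\<in>Units R. u = y \<oplus> c \<otimes> s"
proof (rule ccontr)
  assume not: "\<not> ?thesis"
  interpret P: ideal "Idl (set p)" R by (rule genideal_ideal[OF p])
  let ?B = "{y \<oplus> c \<otimes> s | y c. y \<in> Idl (set p) \<and> c \<in> \<mm>}"
  have "U \<subseteq> ?B"
  proof
    fix u assume u: "u \<in> U"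
    have "u \<in> Idl (insert s (set p))" using u genideal_self[OF U(1)] U(2) by auto
    then obtain y c where yc: "y \<in> Idl (set p)" "c \<in> carrier R" "u = y \<oplus> c \<otimes> s"
      using genideal_insert_subset[OF P.is_ideal genideal_self[OF p] s(1)] by auto
    then have "c \<notin> Units R" using not u by metis
    then show "u \<in> ?B" using yc nonunit_in_maximal by auto
  qed
  then have "Idl U \<subseteq> ?B"
    by (rule genideal_minimal[OF ideal_add_multiples[OF P.is_ideal is_ideal s(1)]])
  \<comment> \<open>\<open>?B\<close> is an ideal containing \<open>U\<close>, so it contains
    \<open>s\<close> as well.\<close>
  moreover have "s \<in> Idl U" using genideal_self[of "set (p @ [s])"] p s(1) U(2) by auto
  ultimately obtain y c where yc: "y \<in> Idl (set p)" "c \<in> \<mm>" "s = y \<oplus> c \<otimes> s" by blast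
  have c: "c \<in> carrier R" and y: "y \<in> carrier R" using yc by auto
  have "(\<one> \<ominus> c) \<otimes> s = s \<ominus> c \<otimes> s"
    using c s(1) by (simp add: minus_eq l_distr l_minus)
  also have "\<dots> = (y \<oplus> c \<otimes> s) \<ominus> c \<otimes> s" using yc(3) by simp
  also have "\<dots> = y" using c y s(1) by (simp add: minus_eq a_assoc r_neg)
  finally have e: "(\<one> \<ominus> c) \<otimes> s = y" .
  have un: "\<one> \<ominus> c \<in> Units R" by (rule one_minus_maximal_Units[OF yc(2)])
  have "s = inv (\<one> \<ominus> c) \<otimes> y"
    using un s(1) c by (simp add: e[symmetric] m_assoc[symmetric])
  then show False using s(2) P.I_l_closed[OF yc(1), of "inv (\<one> \<ominus> c)"] un by simp
qed

end

section \<open>Steinitz exchange in coregular sequences\<close>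

text \<open>On the submodule killed by \<open>p\<close> the summand \<open>y\<close> acts as zero,
  so \<open>u\<close> acts there as \<open>c s\<close>, and the unit factor does not affect
  surjectivity. The ideals agree because \<open>s = inv c \<otimes> (u \<ominus> y)\<close>.\<close>

lemma (in module) coregular_replace_last:
  assumes cor: "coregular M (p @ [s])" and p: "set p \<subseteq> carrier R" and s: "s \<in> carrier R"
    and y: "y \<in> Idl (set p)" and c: "c \<in> Units R" and u: "u = y \<oplus> c \<otimes> s"
  shows "coregular M (p @ [u])" "Idl (set (p @ [u])) = Idl (set (p @ [s]))"
proof -
  interpret P: ideal "Idl (set p)" R by (rule R.genideal_ideal[OF p])
  have cc: "c \<in> carrier R" "inv c \<in> carrier R" and yc: "y \<in> carrier R" using c y by auto
  have uc: "u \<in> carrier R" using u yc cc s by simp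
  have act: "u \<odot>\<^bsub>M\<^esub> x = s \<odot>\<^bsub>M\<^esub> (c \<odot>\<^bsub>M\<^esub> x)" if x: "x \<in> annihilated M (set p)" for x
  proof -
    have "y \<odot>\<^bsub>M\<^esub> x = \<zero>\<^bsub>M\<^esub>" "x \<in> carrier M"
      using x y annihilated_genideal[OF p] by (auto simp: annihilated_def)
    then show ?thesis using u yc cc s by (simp add: smult_l_distr smult_assoc1 smult_comm)
  qed
  note sub = submodule.smult_closed[OF annihilated_submodule[OF p]]
  have "acts_onto M u (set p)"
    unfolding acts_onto_def
  proof
    fix x assume "x \<in> annihilated M (set p)"
    then obtain z where z: "z \<in> annihilated M (set p)" "s \<odot>\<^bsub>M\<^esub> z = x"
      using cor unfolding coregular_snoc acts_onto_def by blast
    have zc: "z \<in> carrier M" using z(1) by (simp add: annihilated_def)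
    have w: "inv c \<odot>\<^bsub>M\<^esub> z \<in> annihilated M (set p)" using sub cc z by blast
    have "c \<odot>\<^bsub>M\<^esub> (inv c \<odot>\<^bsub>M\<^esub> z) = z" using c cc zc by (simp add: smult_assoc1[symmetric])
    then show "\<exists>z\<in>annihilated M (set p). u \<odot>\<^bsub>M\<^esub> z = x" using act[OF w] w z by auto
  qed
  then show "coregular M (p @ [u])" using cor unfolding coregular_snoc by simp
  show "Idl (set (p @ [u])) = Idl (set (p @ [s]))"
  proof
    have ps: "set (p @ [s]) \<subseteq> carrier R" and pu: "set (p @ [u]) \<subseteq> carrier R" using p s uc by auto
    interpret S: ideal "Idl (set (p @ [s]))" R by (rule R.genideal_ideal[OF ps])
    interpret U: ideal "Idl (set (p @ [u]))" R by (rule R.genideal_ideal[OF pu])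
    have yS: "y \<in> Idl (set (p @ [s]))" using y R.subset_Idl_subset[OF ps, of "set p"] by auto
    have yU: "y \<in> Idl (set (p @ [u]))" using y R.subset_Idl_subset[OF pu, of "set p"] by auto
    have "s \<in> Idl (set (p @ [s]))" using R.genideal_self[OF ps] by auto
    then have "u \<in> Idl (set (p @ [s]))"
      using S.a_closed[OF yS S.I_l_closed[OF _ cc(1)]] u by blast
    then show "Idl (set (p @ [u])) \<subseteq> Idl (set (p @ [s]))"
      using R.genideal_self[OF ps] by (intro R.genideal_minimal[OF S.is_ideal]) auto
    have "s = inv c \<otimes> (c \<otimes> s)" using c cc s by (simp add: R.m_assoc[symmetric])
    also have "c \<otimes> s = u \<ominus> y" using u yc cc s by (simp add: R.minus_eq R.a_ac R.r_neg2)
    finally have s_eq: "s = inv c \<otimes> (u \<ominus> y)" .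
    have "u \<in> Idl (set (p @ [u]))" using R.genideal_self[OF pu] by auto
    then have "u \<ominus> y \<in> Idl (set (p @ [u]))"
      unfolding R.minus_eq by (rule U.a_closed[OF _ U.a_inv_closed[OF yU]])
    then have "s \<in> Idl (set (p @ [u]))" using s_eq U.I_l_closed cc(2) by metis
    then show "Idl (set (p @ [s])) \<subseteq> Idl (set (p @ [u]))"
      using R.genideal_self[OF pu] by (intro R.genideal_minimal[OF U.is_ideal]) auto
  qed
qed

text \<open>First exchange, then count: the exchange turns \<open>rs\<close> into a coregular list
  \<open>ws\<close> of members of \<open>us\<close> with the same ideal; it is distinct, and
  comparing lengths makes it a permutation of \<open>us\<close>.\<close>

lemma coregular_generators:
  assumes "noetherian_local_ring R \<mm>" "module R M" "ideal I R" "torsion_on R I M"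
    and cor: "coregular M rs" and rsI: "set rs \<subseteq> I"
    and nz: "annihilated M (set rs) \<noteq> {\<zero>\<^bsub>M\<^esub>}"
    and us: "set us \<subseteq> I" "length us = length rs" "Idl\<^bsub>R\<^esub> (set us) = Idl\<^bsub>R\<^esub> (set rs)"
  shows "coregular M us"
proof -
  interpret noetherian_local_ring R \<mm> by fact
  interpret Mod: module R M by fact
  interpret I: ideal I R by fact
  note tor = I.a_subset assms(4)
  have ann_eq: "annihilated M (set ws) = annihilated M (set rs)"
    if "set ws \<subseteq> I" "Idl\<^bsub>R\<^esub> (set ws) = Idl\<^bsub>R\<^esub> (set rs)" for ws
    using Mod.annihilated_genideal[of "set ws"] Mod.annihilated_genideal[of "set rs"] that rsI I.a_subset
    by (metis subset_trans)
  \<comment> \<open>Invariant after \<open>k\<close> exchanges: \<open>p\<close> holds the members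
    of \<open>us\<close> brought in so far, \<open>t\<close> the entries still to be
    replaced.\<close>
  have "\<exists>p t. length p = k \<and> length (p @ t) = length rs \<and> set p \<subseteq> set us \<and> set (p @ t) \<subseteq> I \<and>
     coregular M (p @ t) \<and> Idl\<^bsub>R\<^esub> (set (p @ t)) = Idl\<^bsub>R\<^esub> (set rs)" if "k \<le> length rs" for k
    using that
  proof (induction k)
    case 0
    then show ?case using cor rsI by (intro exI[of _ "[]"] exI[of _ rs]) auto
  next
    case (Suc k)
    then obtain p t0 where IH: "length p = k" "length (p @ t0) = length rs" "set p \<subseteq> set us"
      "set (p @ t0) \<subseteq> I" "coregular M (p @ t0)" "Idl\<^bsub>R\<^esub> (set (p @ t0)) = Idl\<^bsub>R\<^esub> (set rs)" by auto
    obtain s t where t0: "t0 = s # t" using IH(1,2) Suc.prems by (cases t0) auto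
    \<comment> \<open>\<open>s\<close> is moved to the end, where
      \<open>coregular_notin_genideal\<close> and \<open>coregular_replace_last\<close>
      apply.\<close>
    have co: "coregular M ((p @ t) @ [s])"
      by (rule Mod.coregular_mset[OF IH(5) _ IH(4) tor]) (simp add: t0)
    have st: "set ((p @ t) @ [s]) = set (p @ t0)" by (simp add: t0)
    have car: "set ((p @ t) @ [s]) \<subseteq> carrier R" unfolding st using IH(4) I.a_subset by blast
    have "annihilated M (set ((p @ t) @ [s])) \<noteq> {\<zero>\<^bsub>M\<^esub>}"
      unfolding st using ann_eq[OF IH(4,6)] nz by simp
    then have s: "s \<notin> Idl\<^bsub>R\<^esub> (set (p @ t))" by (rule Mod.coregular_notin_genideal[OF co car])
    have "Idl\<^bsub>R\<^esub> (set us) = Idl\<^bsub>R\<^esub> (set ((p @ t) @ [s]))" unfolding st using IH(6) us(3) by simp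
    then obtain u y c where u: "u \<in> set us" "y \<in> Idl\<^bsub>R\<^esub> (set (p @ t))" "c \<in> Units R"
      "u = y \<oplus>\<^bsub>R\<^esub> c \<otimes>\<^bsub>R\<^esub> s"
      using exchange_generator[OF _ _ s subset_trans[OF us(1) I.a_subset]] car by auto
    have "set (p @ t) \<subseteq> carrier R" "s \<in> carrier R" using car by auto
    from Mod.coregular_replace_last[OF co this u(2-4)]
    have n: "coregular M ((p @ t) @ [u])" "Idl\<^bsub>R\<^esub> (set ((p @ t) @ [u])) = Idl\<^bsub>R\<^esub> (set rs)"
      unfolding st IH(6) .
    have "set ((p @ t) @ [u]) \<subseteq> I" using IH(4) t0 u(1) us(1) by auto
    \<comment> \<open>The new entry moves directly behind \<open>p\<close>, joining the part already
      exchanged.\<close>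
    then have "coregular M ((p @ [u]) @ t)"
      using Mod.coregular_mset[OF n(1) _ _ tor, of "(p @ [u]) @ t"] by simp
    then show ?case
      using IH t0 u(1) us(1) n(2) by (intro exI[of _ "p @ [u]"] exI[of _ t]) auto
  qed
  from this[of "length rs"] obtain ws where ws: "length ws = length rs" "set ws \<subseteq> set us"
    "coregular M ws" "Idl\<^bsub>R\<^esub> (set ws) = Idl\<^bsub>R\<^esub> (set rs)" by auto
  have wsI: "set ws \<subseteq> I" using ws(2) us(1) by blast
  \<comment> \<open>Of two equal entries one, moved to the end, would lie in the ideal of the
    others; this is excluded as before.\<close>
  have dist: "distinct ws"
  proof (rule ccontr)
    assume "\<not> distinct ws"
    then obtain xs zs vs s where d: "ws = xs @ [s] @ zs @ [s] @ vs" using not_distinct_decomp by blast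
    let ?p = "xs @ [s] @ zs @ vs"
    have co: "coregular M (?p @ [s])"
      by (rule Mod.coregular_mset[OF ws(3) _ wsI tor]) (simp add: d)
    have st: "set (?p @ [s]) = set ws" by (auto simp: d)
    have car: "set ws \<subseteq> carrier R" using wsI I.a_subset by blast
    then have "s \<notin> Idl\<^bsub>R\<^esub> (set ?p)"
      using Mod.coregular_notin_genideal[OF co] ann_eq[OF wsI ws(4)] nz unfolding st by simp
    moreover have "set ?p \<subseteq> carrier R" using car by (simp add: d)
    ultimately show False using genideal_self[of "set ?p"] by auto
  qed
  \<comment> \<open>Sandwich: \<open>length us = card (set ws) \<le> card (set us) \<le> length
    us\<close>, so \<open>us\<close> is distinct too and has the same entries as
    \<open>ws\<close>.\<close>
  have "length us = card (set ws)" using dist ws(1) us(2) by (simp add: distinct_card)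
  moreover have "card (set ws) \<le> card (set us)" using ws(2) by (intro card_mono) auto
  ultimately have "card (set us) = length us" using card_length[of us] by simp
  then have "distinct us" by (simp add: card_distinct)
  moreover have "set ws = set us"
    using ws(2) \<open>length us = card (set ws)\<close> \<open>card (set us) = length us\<close>
    by (intro card_subset_eq) auto
  ultimately have "mset ws = mset us" using dist by (simp add: set_eq_iff_mset_eq_distinct)
  then show ?thesis by (rule Mod.coregular_mset[OF ws(3) _ wsI tor])
qed

section \<open>Quotient modules and modules of homomorphisms\<close>

lemma mod_homD:
  assumes "f \<in> mod_hom R M N"
  shows "x \<in> carrier M \<Longrightarrow> f x \<in> carrier N"
    "x \<in> carrier M \<Longrightarrow> y \<in> carrier M \<Longrightarrow> f (x \<oplus>\<^bsub>M\<^esub> y) = f x \<oplus>\<^bsub>N\<^esub> f y"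
    "r \<in> carrier R \<Longrightarrow> x \<in> carrier M \<Longrightarrow> f (r \<odot>\<^bsub>M\<^esub> x) = r \<odot>\<^bsub>N\<^esub> f x"
  using assms by (auto simp: mod_hom_def)

lemma mod_hom_zero:
  assumes "module R M" "module R N" "f \<in> mod_hom R M N"
  shows "f \<zero>\<^bsub>M\<^esub> = \<zero>\<^bsub>N\<^esub>"
proof -
  interpret M: module R M by fact
  interpret N: module R N by fact
  show ?thesis
    using mod_homD(3)[OF assms(3), of "\<zero>\<^bsub>R\<^esub>" "\<zero>\<^bsub>M\<^esub>"] mod_homD(1)[OF assms(3), of "\<zero>\<^bsub>M\<^esub>"] by simp
qed

context module
begin

lemma submodule_abelian_subgroup:
  assumes "submodule N R M"
  shows "abelian_subgroup N M"
  using assms M.abelian_group_axioms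
  by (intro abelian_subgroupI3 additive_subgroup.intro) (auto simp: submodule_def)

lemma carrier_quotient_module:
  "carrier (quotient_module M N) = (\<lambda>x. N +>\<^bsub>M\<^esub> x) ` carrier M"
  by (auto simp: quotient_module_def A_RCOSETS_def' image_def)

lemma rcoset_eq_iff:
  assumes "submodule N R M" "x \<in> carrier M"
  shows "N +>\<^bsub>M\<^esub> x = N \<longleftrightarrow> x \<in> N"
proof -
  interpret abelian_subgroup N M by (rule submodule_abelian_subgroup) fact
  show ?thesis using a_rcos_self[OF assms(2)] a_rcos_const by blast
qed

lemma smult_quotient_module:
  assumes N: "submodule N R M" and r: "r \<in> carrier R" and x: "x \<in> carrier M"
  shows "r \<odot>\<^bsub>quotient_module M N\<^esub> (N +>\<^bsub>M\<^esub> x) = N +>\<^bsub>M\<^esub> (r \<odot>\<^bsub>M\<^esub> x)"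
proof -
  interpret N: abelian_subgroup N M by (rule submodule_abelian_subgroup[OF N])
  have "N +>\<^bsub>M\<^esub> (r \<odot>\<^bsub>M\<^esub> y) = N +>\<^bsub>M\<^esub> (r \<odot>\<^bsub>M\<^esub> x)" if y: "y \<in> N +>\<^bsub>M\<^esub> x" for y
  proof -
    obtain n where n: "n \<in> N" "y = n \<oplus>\<^bsub>M\<^esub> x" using y by (auto simp: a_r_coset_def')
    have "r \<odot>\<^bsub>M\<^esub> y = (r \<odot>\<^bsub>M\<^esub> n) \<oplus>\<^bsub>M\<^esub> (r \<odot>\<^bsub>M\<^esub> x)"
      using n r x by (simp add: smult_r_distr)
    moreover have "r \<odot>\<^bsub>M\<^esub> n \<in> N" using submodule.smult_closed[OF N r n(1)] .
    ultimately have "r \<odot>\<^bsub>M\<^esub> y \<in> N +>\<^bsub>M\<^esub> (r \<odot>\<^bsub>M\<^esub> x)" unfolding a_r_coset_def' by auto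
    then show ?thesis using r x by (intro N.a_repr_independence'[symmetric]) simp_all
  qed
  \<comment> \<open>The definition of the action takes a union over all representatives; every term
    is the same coset, and the index set is nonempty since it contains \<open>x\<close>.\<close>
  then have "(\<Union>y\<in>N +>\<^bsub>M\<^esub> x. N +>\<^bsub>M\<^esub> (r \<odot>\<^bsub>M\<^esub> y)) = (\<Union>y\<in>N +>\<^bsub>M\<^esub> x. N +>\<^bsub>M\<^esub> (r \<odot>\<^bsub>M\<^esub> x))"
    by (intro SUP_cong refl)
  also have "\<dots> = N +>\<^bsub>M\<^esub> (r \<odot>\<^bsub>M\<^esub> x)"
    using N.a_rcos_self[OF x] by (intro cSUP_const) (metis empty_iff)
  finally show ?thesis by (simp add: quotient_module_def)
qed

lemma add_quotient_module:
  assumes N: "submodule N R M" and xy: "x \<in> carrier M" "y \<in> carrier M"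
  shows "(N +>\<^bsub>M\<^esub> x) \<oplus>\<^bsub>quotient_module M N\<^esub> (N +>\<^bsub>M\<^esub> y) = N +>\<^bsub>M\<^esub> (x \<oplus>\<^bsub>M\<^esub> y)"
proof -
  interpret N: abelian_subgroup N M by (rule submodule_abelian_subgroup[OF N])
  show ?thesis using N.a_rcos_sum[OF xy] by (simp add: quotient_module_def)
qed

lemma zero_quotient_module: "\<zero>\<^bsub>quotient_module M N\<^esub> = N"
  by (simp add: quotient_module_def)

lemma module_quotient_module:
  assumes N: "submodule N R M"
  shows "module R (quotient_module M N)" (is "module R ?Q")
proof (rule moduleI)
  interpret N: abelian_subgroup N M by (rule submodule_abelian_subgroup[OF N])
  note q = carrier_quotient_module zero_quotient_module smult_quotient_module[OF N] add_quotient_module[OF N]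
  \<comment> \<open>The zero of the quotient record is \<open>N\<close> itself; rewriting it as a
    coset brings it under the addition rule.\<close>
  have zero: "N = N +>\<^bsub>M\<^esub> \<zero>\<^bsub>M\<^esub>" using rcoset_eq_iff[OF N M.zero_closed] N.zero_closed by metis
  have z': "(N \<oplus>\<^bsub>?Q\<^esub> (N +>\<^bsub>M\<^esub> x)) = N +>\<^bsub>M\<^esub> x" if "x \<in> carrier M" for x
    using add_quotient_module[OF N M.zero_closed that] that zero by simp
  show "cring R" by (rule R.is_cring)
  show "abelian_group ?Q"
  proof (rule abelian_groupI)
    show "\<zero>\<^bsub>?Q\<^esub> \<in> carrier ?Q" unfolding q using zero M.zero_closed by blast
    show "\<exists>Y\<in>carrier ?Q. Y \<oplus>\<^bsub>?Q\<^esub> C = \<zero>\<^bsub>?Q\<^esub>" if C: "C \<in> carrier ?Q" for C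
    proof -
      obtain x where "x \<in> carrier M" "C = N +>\<^bsub>M\<^esub> x" using C by (auto simp: q)
      then show ?thesis
        by (intro bexI[of _ "N +>\<^bsub>M\<^esub> (\<ominus>\<^bsub>M\<^esub> x)"]) (auto simp: q M.l_neg zero[symmetric])
    qed
  qed (auto simp: q z' M.a_ac)
qed (auto simp: carrier_quotient_module smult_quotient_module[OF N] add_quotient_module[OF N]
      smult_l_distr smult_r_distr smult_assoc1)

lemma quotient_projection_hom:
  assumes "submodule N R M"
  shows "(\<lambda>x. N +>\<^bsub>M\<^esub> x) \<in> mod_hom R M (quotient_module M N)"
  using assms by (auto simp: mod_hom_def carrier_quotient_module smult_quotient_module add_quotient_module)

lemma nonzerodivisor_on_quotient_module:
  assumes "submodule N R M" "r \<in> carrier R"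
  shows "nonzerodivisor_on (quotient_module M N) r \<longleftrightarrow>
    (\<forall>x\<in>carrier M. r \<odot>\<^bsub>M\<^esub> x \<in> N \<longrightarrow> x \<in> N)"
  using assms
  by (simp add: nonzerodivisor_on_def carrier_quotient_module zero_quotient_module
      smult_quotient_module rcoset_eq_iff)

lemma zero_module_quotient_module:
  assumes "submodule N R M"
  shows "zero_module (quotient_module M N) \<longleftrightarrow> N = carrier M"
proof -
  have "N \<subseteq> carrier M" by (rule submoduleE(1)[OF assms])
  moreover have "(\<lambda>x. N +>\<^bsub>M\<^esub> x) ` carrier M = {N} \<longleftrightarrow> (\<forall>x\<in>carrier M. N +>\<^bsub>M\<^esub> x = N)"
    using M.zero_closed by auto
  ultimately show ?thesis
    using assms by (auto simp: zero_module_def carrier_quotient_module zero_quotient_module rcoset_eq_iff)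
qed

end

lemma Hom_module_simps:
  "f \<in> carrier (Hom_module R M N) \<longleftrightarrow> f \<in> mod_hom R M N \<and> f \<in> extensional (carrier M)"
  "\<zero>\<^bsub>Hom_module R M N\<^esub> = (\<lambda>x\<in>carrier M. \<zero>\<^bsub>N\<^esub>)"
  "f \<oplus>\<^bsub>Hom_module R M N\<^esub> g = (\<lambda>x\<in>carrier M. f x \<oplus>\<^bsub>N\<^esub> g x)"
  "r \<odot>\<^bsub>Hom_module R M N\<^esub> f = (\<lambda>x\<in>carrier M. r \<odot>\<^bsub>N\<^esub> f x)"
  by (simp_all add: Hom_module_def)

lemma module_Hom_module:
  assumes "module R M" "module R N"
  shows "module R (Hom_module R M N)" (is "module R ?H")
proof (rule moduleI)
  interpret M: module R M by fact
  interpret N: module R N by fact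
  note h = Hom_module_simps
  \<comment> \<open>Extensionality reduces the module axioms to pointwise identities in
    \<open>N\<close>.\<close>
  have ext: "f = g" if "f \<in> carrier ?H" "g \<in> carrier ?H" "\<And>x. x \<in> carrier M \<Longrightarrow> f x = g x" for f g
    using that by (auto simp: h intro: extensionalityI)
  have add: "f \<oplus>\<^bsub>?H\<^esub> g \<in> carrier ?H" if "f \<in> carrier ?H" "g \<in> carrier ?H" for f g
    using that by (auto simp: h mod_hom_def Pi_iff N.M.a_ac N.smult_r_distr)
  have smult: "r \<odot>\<^bsub>?H\<^esub> f \<in> carrier ?H" if "r \<in> carrier R" "f \<in> carrier ?H" for r f
    using that N.smult_comm by (auto simp: h mod_hom_def Pi_iff N.smult_r_distr)
  have zero: "\<zero>\<^bsub>?H\<^esub> \<in> carrier ?H" by (auto simp: h mod_hom_def)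
  have val: "f x \<in> carrier N" if "f \<in> carrier ?H" "x \<in> carrier M" for f x
    using that by (auto simp: h mod_hom_def)
  show "cring R" by (rule M.R.is_cring)
  show "abelian_group ?H"
  proof (rule abelian_groupI)
    show "\<exists>g\<in>carrier ?H. g \<oplus>\<^bsub>?H\<^esub> f = \<zero>\<^bsub>?H\<^esub>" if f: "f \<in> carrier ?H" for f
    proof -
      \<comment> \<open>The additive inverse of \<open>f\<close> is taken as \<open>(-1) f\<close>,
        whose membership follows from closure under scalars.\<close>
      have m: "(\<ominus>\<^bsub>R\<^esub> \<one>\<^bsub>R\<^esub>) \<odot>\<^bsub>?H\<^esub> f \<in> carrier ?H" using f by (intro smult) simp_all
      then have "((\<ominus>\<^bsub>R\<^esub> \<one>\<^bsub>R\<^esub>) \<odot>\<^bsub>?H\<^esub> f) \<oplus>\<^bsub>?H\<^esub> f = \<zero>\<^bsub>?H\<^esub>"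
        using val[OF f] by (intro ext add zero f) (auto simp: h N.smult_l_minus N.M.l_neg)
      with m show ?thesis by blast
    qed
  next
    fix f g k assume "f \<in> carrier ?H" "g \<in> carrier ?H" "k \<in> carrier ?H"
    then show "(f \<oplus>\<^bsub>?H\<^esub> g) \<oplus>\<^bsub>?H\<^esub> k = f \<oplus>\<^bsub>?H\<^esub> (g \<oplus>\<^bsub>?H\<^esub> k)"
      using val by (intro ext add) (simp_all add: Hom_module_simps(3) N.M.a_assoc)
  next
    fix f g assume "f \<in> carrier ?H" "g \<in> carrier ?H"
    then show "f \<oplus>\<^bsub>?H\<^esub> g = g \<oplus>\<^bsub>?H\<^esub> f"
      using val by (intro ext add) (simp_all add: Hom_module_simps(3) N.M.a_comm)
  next
    fix f assume "f \<in> carrier ?H"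
    then show "\<zero>\<^bsub>?H\<^esub> \<oplus>\<^bsub>?H\<^esub> f = f"
      using val zero by (intro ext add) (simp_all add: Hom_module_simps(2,3))
  qed (use add zero in auto)
  show "a \<odot>\<^bsub>?H\<^esub> f \<in> carrier ?H" if "a \<in> carrier R" "f \<in> carrier ?H" for a f
    using that by (rule smult)
  show "(a \<oplus>\<^bsub>R\<^esub> b) \<odot>\<^bsub>?H\<^esub> f = a \<odot>\<^bsub>?H\<^esub> f \<oplus>\<^bsub>?H\<^esub> b \<odot>\<^bsub>?H\<^esub> f"
    if "a \<in> carrier R" "b \<in> carrier R" "f \<in> carrier ?H" for a b f
    using that val by (intro ext add smult) (simp_all add: Hom_module_simps(3,4) N.smult_l_distr)
  show "a \<odot>\<^bsub>?H\<^esub> (f \<oplus>\<^bsub>?H\<^esub> g) = a \<odot>\<^bsub>?H\<^esub> f \<oplus>\<^bsub>?H\<^esub> a \<odot>\<^bsub>?H\<^esub> g"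
    if "a \<in> carrier R" "f \<in> carrier ?H" "g \<in> carrier ?H" for a f g
    using that val by (intro ext add smult) (simp_all add: Hom_module_simps(3,4) N.smult_r_distr)
  show "(a \<otimes>\<^bsub>R\<^esub> b) \<odot>\<^bsub>?H\<^esub> f = a \<odot>\<^bsub>?H\<^esub> (b \<odot>\<^bsub>?H\<^esub> f)"
    if "a \<in> carrier R" "b \<in> carrier R" "f \<in> carrier ?H" for a b f
    using that val by (intro ext smult) (simp_all add: Hom_module_simps(4) N.smult_assoc1)
  show "\<one>\<^bsub>R\<^esub> \<odot>\<^bsub>?H\<^esub> f = f" if "f \<in> carrier ?H" for f
    using that val by (intro ext smult) (simp_all add: Hom_module_simps(4))
qed

text \<open>A linear graph is a homomorphism on its domain, a submodule of \<open>B\<close>, and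
  injectivity of \<open>E\<close> extends it along the inclusion. Later extension problems thus
  reduce to exhibiting a graph; its clause on pairs with first entry zero is their
  well-definedness.\<close>

lemma linear_graph_extends:
  fixes B :: "('a, 'b, 'm) module_scheme"
  assumes E: "injective_module R E" and B: "module R B" and G: "linear_graph R B E G"
  shows "\<exists>g\<in>carrier (Hom_module R B E). \<forall>(x, y)\<in>G. g x = y"
proof -
  have E': "module R E" using E by (simp add: injective_module_def)
  interpret B: module R B by fact
  interpret E: module R E by fact
  note GD = linear_graphD[OF G]
  have sub: "submodule (Domain G) R B"
  proof (rule B.submoduleI)
    show "\<ominus>\<^bsub>B\<^esub> a \<in> Domain G" if "a \<in> Domain G" for a
      using that linear_graph_minus[OF B E' G] by blast
  qed (use GD in blast)+
  let ?A = "B\<lparr>carrier := Domain G\<rparr>"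
  have A: "module R ?A" by (rule submodule.submodule_is_module[OF sub B])
  define f where "f x = (THE y. (x, y) \<in> G)" for x
  have f: "f x = y" if "(x, y) \<in> G" for x y
    unfolding f_def using that linear_graph_functional[OF B E' G] by blast
  have "f \<in> mod_hom R ?A E"
    unfolding mod_hom_def
  proof (intro CollectI conjI ballI funcsetI)
    show "f x \<in> carrier E" if "x \<in> carrier ?A" for x using that f GD(2) by auto
    show "f (x \<oplus>\<^bsub>?A\<^esub> y) = f x \<oplus>\<^bsub>E\<^esub> f y" if "x \<in> carrier ?A" "y \<in> carrier ?A" for x y
      using that f[OF GD(4)] f by auto
    show "f (r \<odot>\<^bsub>?A\<^esub> x) = r \<odot>\<^bsub>E\<^esub> f x" if "r \<in> carrier R" "x \<in> carrier ?A" for r x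
      using that f[OF GD(5)] f by auto
  qed
  moreover have "id \<in> mod_hom R ?A B" using GD(1) by (auto simp: mod_hom_def)
  ultimately obtain g where g: "g \<in> mod_hom R B E" "\<forall>x\<in>carrier ?A. g (id x) = f x"
    using injective_module_lift[OF E A B, of id f] by auto
  \<comment> \<open>\<open>restrict\<close> makes the extension extensional, as membership in
    \<open>Hom_module\<close> demands; values on the domain of \<open>G\<close> are
    unaffected.\<close>
  have "restrict g (carrier B) \<in> carrier (Hom_module R B E)"
    using g(1) by (auto simp: Hom_module_simps mod_hom_def Pi_iff)
  moreover have "\<forall>(x, y)\<in>G. restrict g (carrier B) x = y"
    using g(2) f GD(1) by (auto simp: Domain_iff) (metis DomainI)
  ultimately show ?thesis by blast
qed

section \<open>Matlis duality\<close>

lemma submodule_ring_module: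
  assumes "cring R" "ideal \<aa> R"
  shows "submodule \<aa> R (ring_module R)"
proof -
  interpret cring R by fact
  interpret \<aa>: ideal \<aa> R by fact
  interpret M: module R "ring_module R" by (rule module_ring_module) fact
  show ?thesis
  proof (intro M.submoduleI)
    show "\<ominus>\<^bsub>ring_module R\<^esub> a \<in> \<aa>" if "a \<in> \<aa>" for a
    proof -
      have "\<ominus>\<^bsub>ring_module R\<^esub> a = \<ominus>\<^bsub>R\<^esub> a" by (simp add: a_inv_def m_inv_def ring_module_def)
      then show ?thesis using that by simp
    qed
  qed (auto simp: ring_module_def \<aa>.I_l_closed)
qed

text \<open>The composite of the projection from \<open>R\<close> to \<open>R/\<mm>\<close> with the
  embedding \<open>\<iota>\<close>. Phrased as a map on the ring, it lets functionals be described
  by scalars, without cosets.\<close>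

lemma injective_hull_hom_kernel:
  assumes "cring R" "ideal \<mm> R" "injective_hull R (quotient_module (ring_module R) \<mm>) E \<iota>"
  shows "\<exists>\<kappa>\<in>mod_hom R (ring_module R) E. \<forall>c\<in>carrier R. \<kappa> c = \<zero>\<^bsub>E\<^esub> \<longleftrightarrow> c \<in> \<mm>"
proof -
  let ?M = "ring_module R" and ?Q = "quotient_module (ring_module R) \<mm>"
  interpret M: module R ?M by (rule module_ring_module) fact
  have sub: "submodule \<mm> R ?M" by (rule submodule_ring_module) fact+
  have Q: "module R ?Q" and E: "module R E" and \<iota>: "\<iota> \<in> mod_hom R ?Q E" "inj_on \<iota> (carrier ?Q)"
    using assms(3) by (simp_all add: injective_hull_def injective_module_def)
  interpret Q: module R ?Q by fact
  note pr = M.quotient_projection_hom[OF sub]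
  let ?\<kappa> = "\<lambda>c. \<iota> (\<mm> +>\<^bsub>?M\<^esub> c)"
  have "?\<kappa> \<in> mod_hom R ?M E"
    unfolding mod_hom_def using mod_homD[OF pr] mod_homD[OF \<iota>(1)] by auto
  moreover have "?\<kappa> c = \<zero>\<^bsub>E\<^esub> \<longleftrightarrow> c \<in> \<mm>" if c: "c \<in> carrier R" for c
  proof -
    have c': "c \<in> carrier ?M" using c by (simp add: ring_module_def)
    have "?\<kappa> c = \<zero>\<^bsub>E\<^esub> \<longleftrightarrow> ?\<kappa> c = \<iota> \<zero>\<^bsub>?Q\<^esub>" using mod_hom_zero[OF Q E \<iota>(1)] by simp
    also have "\<dots> \<longleftrightarrow> \<mm> +>\<^bsub>?M\<^esub> c = \<zero>\<^bsub>?Q\<^esub>"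
      using inj_on_eq_iff[OF \<iota>(2) mod_homD(1)[OF pr c'] Q.M.zero_closed] .
    finally show ?thesis using M.rcoset_eq_iff[OF sub c'] M.zero_quotient_module by simp
  qed
  ultimately show ?thesis by (intro bexI[of _ ?\<kappa>]) simp_all
qed

text \<open>
  The functional is \<open>w + c x \<mapsto> \<kappa> c\<close> on \<open>W + R x\<close>, with \<open>\<kappa>\<close> induced by \<open>R / \<mm> \<rightarrow> E\<close>; it is well
  defined since \<open>c x \<in> W\<close> with \<open>x \<notin> W\<close> forces \<open>c\<close> to be a nonunit.
\<close>

lemma dual_separates_points:
  fixes H :: "('a, 'b, 'm) module_scheme"
  assumes "noetherian_local_ring R \<mm>"
    and hull: "injective_hull R (quotient_module (ring_module R) \<mm>) E \<iota>"
    and H: "module R H" and W: "submodule W R H" and x: "x \<in> carrier H" "x \<notin> W"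
  shows "\<exists>g\<in>carrier (Hom_module R H E). (\<forall>w\<in>W. g w = \<zero>\<^bsub>E\<^esub>) \<and> g x \<noteq> \<zero>\<^bsub>E\<^esub>"
proof -
  interpret noetherian_local_ring R \<mm> by fact
  have inj: "injective_module R E" using hull by (simp add: injective_hull_def)
  then have E: "module R E" by (simp add: injective_module_def)
  interpret H: module R H by fact
  interpret E: module R E by fact
  interpret W: submodule W R H by fact
  obtain \<kappa> where \<kappa>: "\<kappa> \<in> mod_hom R (ring_module R) E"
    and ker: "\<And>c. c \<in> carrier R \<Longrightarrow> \<kappa> c = \<zero>\<^bsub>E\<^esub> \<longleftrightarrow> c \<in> \<mm>"
    using injective_hull_hom_kernel[OF is_cring is_ideal hull] by blast
  have k: "\<kappa> c \<in> carrier E" "\<kappa> (c \<oplus>\<^bsub>R\<^esub> c') = \<kappa> c \<oplus>\<^bsub>E\<^esub> \<kappa> c'" "\<kappa> (c \<otimes>\<^bsub>R\<^esub> c') = c \<odot>\<^bsub>E\<^esub> \<kappa> c'"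
    if "c \<in> carrier R" "c' \<in> carrier R" for c c'
    using mod_homD[OF \<kappa>, unfolded ring_module_def] that by simp_all
  have R0: "\<zero>\<^bsub>R\<^esub> \<in> carrier R" and R1: "\<one>\<^bsub>R\<^esub> \<in> carrier R" by simp_all
  note Wc = H.submoduleE[OF W]
  have W_car: "w \<in> carrier H" if "w \<in> W" for w using Wc(1) that by blast
  have zero_W: "\<zero>\<^bsub>H\<^esub> \<in> W" using W.one_closed by simp
  define G where "G = {(w \<oplus>\<^bsub>H\<^esub> c \<odot>\<^bsub>H\<^esub> x, \<kappa> c) | w c. w \<in> W \<and> c \<in> carrier R}"
  have G: "linear_graph R H E G"
    unfolding linear_graph_def
  proof (intro conjI allI impI ballI)
    show "G \<subseteq> carrier H \<times> carrier E" using W_car x k(1) by (auto simp: G_def)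
    have "(\<zero>\<^bsub>H\<^esub>, \<zero>\<^bsub>E\<^esub>) = (\<zero>\<^bsub>H\<^esub> \<oplus>\<^bsub>H\<^esub> \<zero>\<^bsub>R\<^esub> \<odot>\<^bsub>H\<^esub> x, \<kappa> \<zero>\<^bsub>R\<^esub>)"
      using ker[OF R0] x by simp
    then show "(\<zero>\<^bsub>H\<^esub>, \<zero>\<^bsub>E\<^esub>) \<in> G" unfolding G_def using zero_W R0 by blast
  next
    fix u v u' v' assume "(u, v) \<in> G" "(u', v') \<in> G"
    then obtain w c w' c' where *: "u = w \<oplus>\<^bsub>H\<^esub> c \<odot>\<^bsub>H\<^esub> x" "v = \<kappa> c" "u' = w' \<oplus>\<^bsub>H\<^esub> c' \<odot>\<^bsub>H\<^esub> x"
      "v' = \<kappa> c'" "w \<in> W" "w' \<in> W" "c \<in> carrier R" "c' \<in> carrier R" by (auto simp: G_def)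
    have "u \<oplus>\<^bsub>H\<^esub> u' = (w \<oplus>\<^bsub>H\<^esub> w') \<oplus>\<^bsub>H\<^esub> (c \<oplus>\<^bsub>R\<^esub> c') \<odot>\<^bsub>H\<^esub> x"
      using * W_car x by (simp add: H.smult_l_distr H.M.a_ac)
    moreover have a': "c \<oplus>\<^bsub>R\<^esub> c' \<in> carrier R" using * by simp
    moreover have "v \<oplus>\<^bsub>E\<^esub> v' = \<kappa> (c \<oplus>\<^bsub>R\<^esub> c')" using * k(2) by simp
    ultimately show "(u \<oplus>\<^bsub>H\<^esub> u', v \<oplus>\<^bsub>E\<^esub> v') \<in> G"
      unfolding G_def using Wc(5)[OF *(5,6)] a' by blast
  next
    fix r u v assume r: "r \<in> carrier R" and "(u, v) \<in> G"
    then obtain w c where *: "u = w \<oplus>\<^bsub>H\<^esub> c \<odot>\<^bsub>H\<^esub> x" "v = \<kappa> c" "w \<in> W" "c \<in> carrier R"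
      by (auto simp: G_def)
    have "r \<odot>\<^bsub>H\<^esub> u = r \<odot>\<^bsub>H\<^esub> w \<oplus>\<^bsub>H\<^esub> (r \<otimes>\<^bsub>R\<^esub> c) \<odot>\<^bsub>H\<^esub> x"
      using * W_car x r by (simp add: H.smult_r_distr H.smult_assoc1)
    moreover have m': "r \<otimes>\<^bsub>R\<^esub> c \<in> carrier R" using * r by simp
    moreover have "r \<odot>\<^bsub>E\<^esub> v = \<kappa> (r \<otimes>\<^bsub>R\<^esub> c)" using * k(3) r by simp
    ultimately show "(r \<odot>\<^bsub>H\<^esub> u, r \<odot>\<^bsub>E\<^esub> v) \<in> G"
      unfolding G_def using Wc(4)[OF r *(3)] m' by blast
  next
    fix v assume "(\<zero>\<^bsub>H\<^esub>, v) \<in> G"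
    then obtain w c where *: "\<zero>\<^bsub>H\<^esub> = w \<oplus>\<^bsub>H\<^esub> c \<odot>\<^bsub>H\<^esub> x" "v = \<kappa> c" "w \<in> W" "c \<in> carrier R"
      by (auto simp: G_def)
    have cx: "c \<odot>\<^bsub>H\<^esub> x = \<ominus>\<^bsub>H\<^esub> w"
      using * x W_car H.M.minus_equality[of "c \<odot>\<^bsub>H\<^esub> x" w] H.M.a_comm[of w "c \<odot>\<^bsub>H\<^esub> x"] by simp
    have "c \<notin> Units R"
    proof
      assume c: "c \<in> Units R"
      then have "x = inv\<^bsub>R\<^esub> c \<odot>\<^bsub>H\<^esub> (c \<odot>\<^bsub>H\<^esub> x)"
        using x *(4) by (simp add: H.smult_assoc1[symmetric])
      also have "\<dots> \<in> W" unfolding cx using c Wc(3)[OF *(3)] by (intro Wc(4)) simp_all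
      finally show False using x(2) by simp
    qed
    then show "v = \<zero>\<^bsub>E\<^esub>" using nonunit_in_maximal *(2,4) ker by blast
  qed
  obtain g where g: "g \<in> carrier (Hom_module R H E)" "\<forall>(u, v)\<in>G. g u = v"
    using linear_graph_extends[OF inj H G] by blast
  have "g w = \<zero>\<^bsub>E\<^esub>" if w: "w \<in> W" for w
  proof -
    have "(w, \<kappa> \<zero>\<^bsub>R\<^esub>) = (w \<oplus>\<^bsub>H\<^esub> \<zero>\<^bsub>R\<^esub> \<odot>\<^bsub>H\<^esub> x, \<kappa> \<zero>\<^bsub>R\<^esub>)" using w W_car x by simp
    then have "(w, \<kappa> \<zero>\<^bsub>R\<^esub>) \<in> G" unfolding G_def using w R0 by blast
    then show ?thesis using g(2) ker[OF R0] by auto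
  qed
  moreover have "g x \<noteq> \<zero>\<^bsub>E\<^esub>"
  proof -
    \<comment> \<open>The coefficient one is sent to a nonzero value because
      \<open>\<one> \<notin> \<mm>\<close>.\<close>
    have "(x, \<kappa> \<one>\<^bsub>R\<^esub>) = (\<zero>\<^bsub>H\<^esub> \<oplus>\<^bsub>H\<^esub> \<one>\<^bsub>R\<^esub> \<odot>\<^bsub>H\<^esub> x, \<kappa> \<one>\<^bsub>R\<^esub>)" using x by simp
    then have "(x, \<kappa> \<one>\<^bsub>R\<^esub>) \<in> G" unfolding G_def using zero_W R1 by blast
    then show ?thesis using g(2) ker[OF R1] one_notin_maximal by auto
  qed
  ultimately show ?thesis using g(1) by blast
qed

lemma vanishing_submodule:
  assumes "module R H" "module R E" "T \<subseteq> carrier H"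
  shows "submodule {f \<in> carrier (Hom_module R H E). \<forall>x\<in>T. f x = \<zero>\<^bsub>E\<^esub>} R (Hom_module R H E)"
    (is "submodule ?V R ?D")
proof -
  interpret E: module R E by fact
  interpret D: module R ?D by (rule module_Hom_module) fact+
  have sm: "r \<odot>\<^bsub>?D\<^esub> f \<in> ?V" if "r \<in> carrier R" "f \<in> ?V" for r f
    using that D.smult_closed[of r f] assms(3) by (auto simp: Hom_module_simps(4) subset_iff)
  show ?thesis
  proof (rule D.submoduleI)
    show "\<ominus>\<^bsub>?D\<^esub> f \<in> ?V" if "f \<in> ?V" for f
      using sm[OF _ that, of "\<ominus>\<^bsub>R\<^esub> \<one>\<^bsub>R\<^esub>"] that D.smult_l_minus[of "\<one>\<^bsub>R\<^esub>" f] by simp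
    show "f \<oplus>\<^bsub>?D\<^esub> g \<in> ?V" if "f \<in> ?V" "g \<in> ?V" for f g
      using that D.M.a_closed[of f g] assms(3) by (auto simp: Hom_module_simps(3) subset_iff)
    show "\<zero>\<^bsub>?D\<^esub> \<in> ?V"
      using D.M.zero_closed assms(3) by (auto simp: Hom_module_simps(2) subset_iff)
  qed (use sm in auto)
qed

text \<open>
  Induction on the sequence: if \<open>f\<close> vanishes on the part of \<open>Z = annihilated H (set rs)\<close> killed by
  \<open>a\<close>, then \<open>a z \<mapsto> f z\<close> is well defined on \<open>a Z\<close> and extends to some \<open>g\<close>, and \<open>f - a g\<close> vanishes
  on \<open>Z\<close>.
\<close>

lemma vanishing_on_annihilated:
  assumes inj: "injective_module R E" and H: "module R H"
    and N: "submodule N R (Hom_module R H E)"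
    and rs: "set rs \<subseteq> carrier R"
      "\<And>r g. r \<in> set rs \<Longrightarrow> g \<in> carrier (Hom_module R H E) \<Longrightarrow> r \<odot>\<^bsub>Hom_module R H E\<^esub> g \<in> N"
    and f: "f \<in> carrier (Hom_module R H E)" "\<And>x. x \<in> annihilated H (set rs) \<Longrightarrow> f x = \<zero>\<^bsub>E\<^esub>"
  shows "f \<in> N"
  using rs f
proof (induction rs arbitrary: f rule: rev_induct)
  have E: "module R E" using inj by (simp add: injective_module_def)
  interpret E: module R E by fact
  interpret H: module R H by fact
  let ?D = "Hom_module R H E"
  interpret D: module R ?D by (rule module_Hom_module) fact+
  note NE = D.submoduleE[OF N]
  have zero_N: "\<zero>\<^bsub>?D\<^esub> \<in> N" using subgroup.one_closed[of N "add_monoid ?D"] N by (simp add: submodule_def)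
  {
    case Nil
    \<comment> \<open>For the empty list the annihilated submodule is all of \<open>H\<close>, so
      \<open>f\<close> is zero.\<close>
    have "f x = \<zero>\<^bsub>E\<^esub>" if "x \<in> carrier H" for x using Nil(4) that by (simp add: annihilated_def)
    then have "f = \<zero>\<^bsub>?D\<^esub>"
      using Nil(3) by (auto simp: Hom_module_simps intro: extensionalityI)
    then show ?case using zero_N by simp
  next
    case (snoc a rs)
    have a: "a \<in> carrier R" and rs: "set rs \<subseteq> carrier R" using snoc.prems(1) by auto
    note Z = H.annihilated_submodule[OF rs]
    note ZE = H.submoduleE[OF Z]
    have Zc: "z \<in> carrier H" if "z \<in> annihilated H (set rs)" for z using that ZE(1) by blast
    have fh: "f \<in> mod_hom R H E" using snoc.prems(3) by (simp add: Hom_module_simps)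
    define G where "G = {(a \<odot>\<^bsub>H\<^esub> z, f z) | z. z \<in> annihilated H (set rs)}"
    have "linear_graph R H E G"
      unfolding linear_graph_def
    proof (intro conjI allI impI ballI)
      show "G \<subseteq> carrier H \<times> carrier E" using a Zc mod_homD(1)[OF fh] by (auto simp: G_def)
      have "(\<zero>\<^bsub>H\<^esub>, \<zero>\<^bsub>E\<^esub>) = (a \<odot>\<^bsub>H\<^esub> \<zero>\<^bsub>H\<^esub>, f \<zero>\<^bsub>H\<^esub>)" using a mod_hom_zero[OF H E fh] by simp
      then show "(\<zero>\<^bsub>H\<^esub>, \<zero>\<^bsub>E\<^esub>) \<in> G" unfolding G_def using H.zero_in_annihilated[OF rs] by blast
    next
      fix u v u' v' assume "(u, v) \<in> G" "(u', v') \<in> G"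
      then obtain z z' where *: "u = a \<odot>\<^bsub>H\<^esub> z" "v = f z" "u' = a \<odot>\<^bsub>H\<^esub> z'" "v' = f z'"
        "z \<in> annihilated H (set rs)" "z' \<in> annihilated H (set rs)" by (auto simp: G_def)
      then have "u \<oplus>\<^bsub>H\<^esub> u' = a \<odot>\<^bsub>H\<^esub> (z \<oplus>\<^bsub>H\<^esub> z')" "v \<oplus>\<^bsub>E\<^esub> v' = f (z \<oplus>\<^bsub>H\<^esub> z')"
        using a Zc mod_homD(2)[OF fh] by (simp_all add: H.smult_r_distr)
      then show "(u \<oplus>\<^bsub>H\<^esub> u', v \<oplus>\<^bsub>E\<^esub> v') \<in> G" unfolding G_def using ZE(5)[OF *(5,6)] by blast
    next
      fix r u v assume r: "r \<in> carrier R" and "(u, v) \<in> G"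
      then obtain z where *: "u = a \<odot>\<^bsub>H\<^esub> z" "v = f z" "z \<in> annihilated H (set rs)"
        by (auto simp: G_def)
      then have "r \<odot>\<^bsub>H\<^esub> u = a \<odot>\<^bsub>H\<^esub> (r \<odot>\<^bsub>H\<^esub> z)" "r \<odot>\<^bsub>E\<^esub> v = f (r \<odot>\<^bsub>H\<^esub> z)"
        using a r Zc mod_homD(3)[OF fh r] H.smult_comm by simp_all
      then show "(r \<odot>\<^bsub>H\<^esub> u, r \<odot>\<^bsub>E\<^esub> v) \<in> G" unfolding G_def using ZE(4)[OF r *(3)] by blast
    next
      fix v assume "(\<zero>\<^bsub>H\<^esub>, v) \<in> G"
      then obtain z where *: "a \<odot>\<^bsub>H\<^esub> z = \<zero>\<^bsub>H\<^esub>" "v = f z" "z \<in> annihilated H (set rs)"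
        by (auto simp: G_def)
      then have "z \<in> annihilated H (set (rs @ [a]))" by (simp add: annihilated_def)
      then show "v = \<zero>\<^bsub>E\<^esub>" using snoc.prems(4) *(2) by blast
    qed
    then obtain g where g: "g \<in> carrier ?D" "\<forall>(x, y)\<in>G. g x = y"
      using linear_graph_extends[OF inj H] by blast
    have gh: "g \<in> mod_hom R H E" using g(1) by (simp add: Hom_module_simps)
    \<comment> \<open>This is \<open>f - a g\<close>, written with the scalar \<open>-a\<close> so
      that its values follow from the rules for sums and multiples.\<close>
    let ?k = "f \<oplus>\<^bsub>?D\<^esub> (\<ominus>\<^bsub>R\<^esub> a) \<odot>\<^bsub>?D\<^esub> g"
    have mag: "(\<ominus>\<^bsub>R\<^esub> a) \<odot>\<^bsub>?D\<^esub> g = \<ominus>\<^bsub>?D\<^esub> (a \<odot>\<^bsub>?D\<^esub> g)" by (rule D.smult_l_minus[OF a g(1)])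
    have ag: "a \<odot>\<^bsub>?D\<^esub> g \<in> N" using snoc.prems(2) g(1) by simp
    have "?k \<in> N"
    proof (rule snoc.IH[OF rs])
      show "r \<odot>\<^bsub>?D\<^esub> g \<in> N" if "r \<in> set rs" "g \<in> carrier ?D" for r g
        using snoc.prems(2) that by simp
      show "?k \<in> carrier ?D" using snoc.prems(3) a g(1) by simp
      fix x assume x: "x \<in> annihilated H (set rs)"
      then have "g (a \<odot>\<^bsub>H\<^esub> x) = f x" using g(2) by (auto simp: G_def)
      then have "a \<odot>\<^bsub>E\<^esub> g x = f x" using mod_homD(3)[OF gh a] Zc[OF x] by simp
      then show "?k x = \<zero>\<^bsub>E\<^esub>"
        using Zc[OF x] a mod_homD(1)[OF fh] mod_homD(1)[OF gh]
        by (simp add: Hom_module_simps(3,4) E.smult_l_minus E.M.r_neg)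
    qed
    then have "?k \<oplus>\<^bsub>?D\<^esub> (a \<odot>\<^bsub>?D\<^esub> g) \<in> N" using ag by (rule NE(5))
    moreover have "?k \<oplus>\<^bsub>?D\<^esub> (a \<odot>\<^bsub>?D\<^esub> g) = f"
      using snoc.prems(3) a g(1) by (simp add: mag D.M.a_assoc D.M.l_neg)
    ultimately show ?case by simp
  }
qed

text \<open>The quotient of the dual by this submodule is the dual of
  \<open>annihilated H (set rs)\<close>. One inclusion holds since the ideal kills that submodule;
  the other applies \<open>vanishing_on_annihilated\<close> to every \<open>N\<close> in the
  intersection defining \<open>ideal_smult\<close>.\<close>

lemma ideal_smult_Hom_module:
  assumes inj: "injective_module R E" and H: "module R H" and rs: "set rs \<subseteq> carrier R"
  shows "ideal_smult R (Idl\<^bsub>R\<^esub> (set rs)) (Hom_module R H E) =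
    {f \<in> carrier (Hom_module R H E). \<forall>x\<in>annihilated H (set rs). f x = \<zero>\<^bsub>E\<^esub>}"
    (is "ideal_smult R ?I ?D = ?V")
proof
  have E: "module R E" using inj by (simp add: injective_module_def)
  interpret E: module R E by fact
  interpret H: module R H by fact
  have V: "submodule ?V R ?D"
    by (rule vanishing_submodule[OF H E]) (auto simp: annihilated_def)
  interpret D: module R ?D by (rule module_Hom_module) fact+
  have "a \<odot>\<^bsub>?D\<^esub> f \<in> ?V" if a: "a \<in> ?I" and f: "f \<in> carrier ?D" for a f
  proof -
    have aR: "a \<in> carrier R" using a ideal.Icarr[OF E.R.genideal_ideal[OF rs]] by blast
    have fh: "f \<in> mod_hom R H E" using f by (simp add: Hom_module_simps)
    have "(a \<odot>\<^bsub>?D\<^esub> f) x = \<zero>\<^bsub>E\<^esub>" if x: "x \<in> annihilated H (set rs)" for x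
    proof -
      have "x \<in> carrier H" "a \<odot>\<^bsub>H\<^esub> x = \<zero>\<^bsub>H\<^esub>"
        using x a H.annihilated_genideal[OF rs] by (auto simp: annihilated_def)
      then show ?thesis
        using mod_homD(3)[OF fh aR, of x] mod_hom_zero[OF H E fh] by (simp add: Hom_module_simps(4))
    qed
    then show ?thesis using aR f by simp
  qed
  then show "ideal_smult R ?I ?D \<subseteq> ?V" using V unfolding ideal_smult_def by blast
  show "?V \<subseteq> ideal_smult R ?I ?D"
  proof
    fix f assume f: "f \<in> ?V"
    have "f \<in> N" if N: "submodule N R ?D" "\<forall>a\<in>?I. \<forall>x\<in>carrier ?D. a \<odot>\<^bsub>?D\<^esub> x \<in> N" for N
    proof (rule vanishing_on_annihilated[OF inj H N(1) rs])
      show "r \<odot>\<^bsub>?D\<^esub> g \<in> N" if "r \<in> set rs" "g \<in> carrier ?D" for r g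
        using N(2) that E.R.genideal_self[OF rs] by blast
    qed (use f in auto)
    then show "f \<in> ideal_smult R ?I ?D" by (auto simp: ideal_smult_def)
  qed
qed

text \<open>Let \<open>N\<close> be the submodule killed by the preceding entries. By
  \<open>ideal_smult_Hom_module\<close>, \<open>r\<close> is a nonzerodivisor on the quotient iff
  every functional vanishing on \<open>r N\<close> vanishes on \<open>N\<close>. As functionals
  separate points from submodules, this says \<open>r N = N\<close>; likewise the last quotient is
  zero iff the last annihilated submodule is.\<close>

lemma regular_sequence_dual_iff:
  fixes H :: "('a, 'b, 'm) module_scheme"
  assumes loc: "noetherian_local_ring R \<mm>"
    and hull: "injective_hull R (quotient_module (ring_module R) \<mm>) E \<iota>"
    and H: "module R H" and rs: "set rs \<subseteq> carrier R"
  shows "regular_sequence R (matlis_dual R E H) rs \<longleftrightarrow>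
    coregular H rs \<and> annihilated H (set rs) \<noteq> {\<zero>\<^bsub>H\<^esub>}"
proof -
  have inj: "injective_module R E" using hull by (simp add: injective_hull_def)
  then have E: "module R E" by (simp add: injective_module_def)
  interpret H: module R H by fact
  interpret E: module R E by fact
  let ?D = "Hom_module R H E"
  interpret D: module R ?D by (rule module_Hom_module) fact+
  have S: "submodule (ideal_smult R (Idl\<^bsub>R\<^esub> (set ps)) ?D) R ?D" if "set ps \<subseteq> carrier R" for ps
    unfolding ideal_smult_Hom_module[OF inj H that]
    by (rule vanishing_submodule[OF H E]) (auto simp: annihilated_def)
  have nzd: "nonzerodivisor_on (quotient_module ?D (ideal_smult R (Idl\<^bsub>R\<^esub> (set ps)) ?D)) r
      \<longleftrightarrow> acts_onto H r (set ps)" (is "?nzd \<longleftrightarrow> ?onto")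
    if ps: "set ps \<subseteq> carrier R" and r: "r \<in> carrier R" for ps r
  proof -
    let ?N = "annihilated H (set ps)"
    note N = H.annihilated_submodule[OF ps]
    have Nc: "x \<in> carrier H" if "x \<in> ?N" for x using that by (simp add: annihilated_def)
    have rf: "(r \<odot>\<^bsub>?D\<^esub> f) x = f (r \<odot>\<^bsub>H\<^esub> x)" if "f \<in> carrier ?D" "x \<in> ?N" for f x
      using that r Nc mod_homD(3)[of f R H E r x] by (simp add: Hom_module_simps)
    have "?nzd \<longleftrightarrow> (\<forall>f\<in>carrier ?D. (\<forall>x\<in>?N. f (r \<odot>\<^bsub>H\<^esub> x) = \<zero>\<^bsub>E\<^esub>) \<longrightarrow> (\<forall>x\<in>?N. f x = \<zero>\<^bsub>E\<^esub>))"
      using D.nonzerodivisor_on_quotient_module[OF S[OF ps] r]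
      unfolding ideal_smult_Hom_module[OF inj H ps] using r rf by auto
    also have "\<dots> \<longleftrightarrow> ?onto"
    proof
      assume van: "\<forall>f\<in>carrier ?D. (\<forall>x\<in>?N. f (r \<odot>\<^bsub>H\<^esub> x) = \<zero>\<^bsub>E\<^esub>) \<longrightarrow> (\<forall>x\<in>?N. f x = \<zero>\<^bsub>E\<^esub>)"
      let ?W = "(\<lambda>y. r \<odot>\<^bsub>H\<^esub> y) ` ?N"
      have W: "submodule ?W R H"
      proof (rule H.submoduleI)
        show "?W \<subseteq> carrier H" using r Nc by auto
        show "\<zero>\<^bsub>H\<^esub> \<in> ?W"
          using r H.zero_in_annihilated[OF ps] by (intro image_eqI[of _ _ "\<zero>\<^bsub>H\<^esub>"]) simp_all
        show "\<ominus>\<^bsub>H\<^esub> w \<in> ?W" if "w \<in> ?W" for w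
          using that r Nc H.submoduleE(3)[OF N] by (auto simp: H.smult_r_minus[symmetric])
        show "w \<oplus>\<^bsub>H\<^esub> w' \<in> ?W" if "w \<in> ?W" "w' \<in> ?W" for w w'
          using that r Nc H.submoduleE(5)[OF N] by (auto simp: H.smult_r_distr[symmetric])
        show "c \<odot>\<^bsub>H\<^esub> w \<in> ?W" if "c \<in> carrier R" "w \<in> ?W" for c w
          using that r Nc H.submoduleE(4)[OF N] by (auto simp: H.smult_comm[of c r])
      qed
      show ?onto
        unfolding acts_onto_def
      proof (rule ballI, rule ccontr)
        fix x assume x: "x \<in> ?N" and "\<not> (\<exists>y\<in>?N. r \<odot>\<^bsub>H\<^esub> y = x)"
        then have "x \<notin> ?W" by auto
        then obtain g where "g \<in> carrier ?D" "\<forall>w\<in>?W. g w = \<zero>\<^bsub>E\<^esub>" "g x \<noteq> \<zero>\<^bsub>E\<^esub>"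
          using dual_separates_points[OF loc hull H W Nc[OF x]] by blast
        then show False using van x by auto
      qed
    next
      assume onto: ?onto
      show "\<forall>f\<in>carrier ?D. (\<forall>x\<in>?N. f (r \<odot>\<^bsub>H\<^esub> x) = \<zero>\<^bsub>E\<^esub>) \<longrightarrow> (\<forall>x\<in>?N. f x = \<zero>\<^bsub>E\<^esub>)"
      proof (intro ballI impI)
        fix f x assume f: "\<forall>x\<in>?N. f (r \<odot>\<^bsub>H\<^esub> x) = \<zero>\<^bsub>E\<^esub>" and "x \<in> ?N"
        then obtain y where "y \<in> ?N" "r \<odot>\<^bsub>H\<^esub> y = x" using onto unfolding acts_onto_def by blast
        then show "f x = \<zero>\<^bsub>E\<^esub>" using f by auto
      qed
    qed
    finally show ?thesis .
  qed
  have nonzero: "zero_module (quotient_module ?D (ideal_smult R (Idl\<^bsub>R\<^esub> (set rs)) ?D))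
      \<longleftrightarrow> annihilated H (set rs) = {\<zero>\<^bsub>H\<^esub>}" (is "?z \<longleftrightarrow> ?a")
  proof -
    have "?z \<longleftrightarrow> (\<forall>f\<in>carrier ?D. \<forall>x\<in>annihilated H (set rs). f x = \<zero>\<^bsub>E\<^esub>)"
      using D.zero_module_quotient_module[OF S[OF rs]]
      unfolding ideal_smult_Hom_module[OF inj H rs] by auto
    also have "\<dots> \<longleftrightarrow> ?a"
    proof
      assume van: "\<forall>f\<in>carrier ?D. \<forall>x\<in>annihilated H (set rs). f x = \<zero>\<^bsub>E\<^esub>"
      \<comment> \<open>Separation from the zero submodule: at a nonzero element some functional
        does not vanish.\<close>
      have z: "submodule {\<zero>\<^bsub>H\<^esub>} R H" by (rule H.submoduleI) auto
      have "x = \<zero>\<^bsub>H\<^esub>" if "x \<in> annihilated H (set rs)" for x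
      proof (rule ccontr)
        assume "x \<noteq> \<zero>\<^bsub>H\<^esub>"
        then have "x \<notin> {\<zero>\<^bsub>H\<^esub>}" by simp
        moreover have "x \<in> carrier H" using that by (simp add: annihilated_def)
        ultimately show False using dual_separates_points[OF loc hull H z] van that by blast
      qed
      then show ?a using H.zero_in_annihilated[OF rs] by blast
    next
      assume ?a
      then show "\<forall>f\<in>carrier ?D. \<forall>x\<in>annihilated H (set rs). f x = \<zero>\<^bsub>E\<^esub>"
        using mod_hom_zero[OF H E] by (simp add: Hom_module_simps)
    qed
    finally show ?thesis .
  qed
  have "acts_onto H (rs ! i) (set (take i rs)) \<longleftrightarrow>
      nonzerodivisor_on (quotient_module ?D (ideal_smult R (Idl\<^bsub>R\<^esub> (set (take i rs))) ?D)) (rs ! i)"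
    if "i < length rs" for i
    using nzd[of "take i rs" "rs ! i"] rs nth_mem[OF that] set_take_subset[of i rs] by blast
  then show ?thesis
    using rs nonzero by (simp add: regular_sequence_def matlis_dual_def coregular_def)
qed

section \<open>Local cohomology modules are torsion\<close>

lemma (in cring) ideal_power_ideal:
  assumes "ideal I R"
  shows "ideal (I [^]\<^bsub>ideals_set R\<^esub> (n::nat)) R"
proof -
  interpret L: comm_monoid "ideals_set R" by (rule ideals_set_is_comm_monoid)
  show ?thesis using L.nat_pow_closed[of I n] assms by (simp add: ideals_set_def)
qed

text \<open>The higher power is a product with the lower one as a factor. This is what lets the
  larger of two exponents kill a sum of torsion elements.\<close>

lemma (in cring) ideal_power_antimono:
  assumes "ideal I R" "n \<le> m"
  shows "I [^]\<^bsub>ideals_set R\<^esub> (m::nat) \<subseteq> I [^]\<^bsub>ideals_set R\<^esub> n"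
proof -
  interpret L: comm_monoid "ideals_set R" by (rule ideals_set_is_comm_monoid)
  have "I \<in> carrier (ideals_set R)" using assms(1) by (simp add: ideals_set_def)
  then have "I [^]\<^bsub>ideals_set R\<^esub> m = I [^]\<^bsub>ideals_set R\<^esub> n \<otimes>\<^bsub>ideals_set R\<^esub> I [^]\<^bsub>ideals_set R\<^esub> (m - n)"
    using L.nat_pow_mult[of I n "m - n"] assms(2) by simp
  moreover have "A \<otimes>\<^bsub>ideals_set R\<^esub> B = ideal_prod R A B" for A B by (simp add: ideals_set_def)
  ultimately show ?thesis
    using ideal_prod_inter[OF ideal_power_ideal[OF assms(1)] ideal_power_ideal[OF assms(1)], of n "m - n"]
    by simp
qed

lemma (in cring) pow_in_ideal_power:
  assumes "ideal I R" "r \<in> I"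
  shows "r [^] (n::nat) \<in> I [^]\<^bsub>ideals_set R\<^esub> n"
proof (induction n)
  case 0
  \<comment> \<open>The zeroth power is the unit ideal.\<close>
  then show ?case by (simp add: ideals_set_def nat_pow_def)
next
  case (Suc n)
  then show ?case using assms(2) by (simp add: ideals_set_def ideal_prod.prod)
qed

lemma torsion_part_submodule:
  assumes "module R M" "ideal I R"
  shows "submodule (torsion_part R I M) R M"
proof -
  interpret M: module R M by fact
  have car: "a \<in> carrier R" if "a \<in> I [^]\<^bsub>ideals_set R\<^esub> (n::nat)" for a n
    using ideal.Icarr[OF M.R.ideal_power_ideal[OF assms(2)] that] .
  show ?thesis
  proof (rule M.submoduleI)
    show "torsion_part R I M \<subseteq> carrier M" by (auto simp: torsion_part_def)
    show "\<zero>\<^bsub>M\<^esub> \<in> torsion_part R I M" using car by (auto simp: torsion_part_def)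
    show "\<ominus>\<^bsub>M\<^esub> x \<in> torsion_part R I M" if x: "x \<in> torsion_part R I M" for x
    proof -
      obtain n :: nat where "\<forall>a\<in>I [^]\<^bsub>ideals_set R\<^esub> n. a \<odot>\<^bsub>M\<^esub> x = \<zero>\<^bsub>M\<^esub>" and xc: "x \<in> carrier M"
        using x by (auto simp: torsion_part_def)
      then have "\<forall>a\<in>I [^]\<^bsub>ideals_set R\<^esub> n. a \<odot>\<^bsub>M\<^esub> (\<ominus>\<^bsub>M\<^esub> x) = \<zero>\<^bsub>M\<^esub>"
        using car by (simp add: M.smult_r_minus)
      then show ?thesis using xc by (auto simp: torsion_part_def)
    qed
    show "x \<oplus>\<^bsub>M\<^esub> y \<in> torsion_part R I M" if x: "x \<in> torsion_part R I M" and y: "y \<in> torsion_part R I M" for x y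
    proof -
      obtain n m :: nat where nm: "\<forall>a\<in>I [^]\<^bsub>ideals_set R\<^esub> n. a \<odot>\<^bsub>M\<^esub> x = \<zero>\<^bsub>M\<^esub>"
        "\<forall>a\<in>I [^]\<^bsub>ideals_set R\<^esub> m. a \<odot>\<^bsub>M\<^esub> y = \<zero>\<^bsub>M\<^esub>" and xy: "x \<in> carrier M" "y \<in> carrier M"
        using x y by (auto simp: torsion_part_def)
      have "\<forall>a\<in>I [^]\<^bsub>ideals_set R\<^esub> (max n m). a \<odot>\<^bsub>M\<^esub> (x \<oplus>\<^bsub>M\<^esub> y) = \<zero>\<^bsub>M\<^esub>"
      proof
        fix a assume a: "a \<in> I [^]\<^bsub>ideals_set R\<^esub> (max n m)"
        then have "a \<in> I [^]\<^bsub>ideals_set R\<^esub> n" "a \<in> I [^]\<^bsub>ideals_set R\<^esub> m"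
          using M.R.ideal_power_antimono[OF assms(2) max.cobounded1[of n m]]
            M.R.ideal_power_antimono[OF assms(2) max.cobounded2[of m n]] by auto
        then show "a \<odot>\<^bsub>M\<^esub> (x \<oplus>\<^bsub>M\<^esub> y) = \<zero>\<^bsub>M\<^esub>" using nm xy car[OF a] by (simp add: M.smult_r_distr)
      qed
      then show ?thesis using xy unfolding torsion_part_def by auto
    qed
    show "r \<odot>\<^bsub>M\<^esub> x \<in> torsion_part R I M" if r: "r \<in> carrier R" and x: "x \<in> torsion_part R I M" for r x
    proof -
      obtain n :: nat where n: "\<forall>a\<in>I [^]\<^bsub>ideals_set R\<^esub> n. a \<odot>\<^bsub>M\<^esub> x = \<zero>\<^bsub>M\<^esub>" and xc: "x \<in> carrier M"
        using x by (auto simp: torsion_part_def)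
      then have "\<forall>a\<in>I [^]\<^bsub>ideals_set R\<^esub> n. a \<odot>\<^bsub>M\<^esub> (r \<odot>\<^bsub>M\<^esub> x) = \<zero>\<^bsub>M\<^esub>"
        using car r M.smult_comm[of _ r x] by simp
      then show ?thesis using xc r by (auto simp: torsion_part_def)
    qed
  qed
qed

lemma mod_hom_torsion_part:
  assumes "module R M" "module R N" "ideal I R" "f \<in> mod_hom R M N" "x \<in> torsion_part R I M"
  shows "f x \<in> torsion_part R I N"
proof -
  interpret M: module R M by fact
  obtain n :: nat where n: "\<forall>a\<in>I [^]\<^bsub>ideals_set R\<^esub> n. a \<odot>\<^bsub>M\<^esub> x = \<zero>\<^bsub>M\<^esub>" and x: "x \<in> carrier M"
    using assms(5) by (auto simp: torsion_part_def)
  have "a \<odot>\<^bsub>N\<^esub> f x = \<zero>\<^bsub>N\<^esub>" if a: "a \<in> I [^]\<^bsub>ideals_set R\<^esub> n" for a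
  proof -
    have "a \<in> carrier R" using ideal.Icarr[OF M.R.ideal_power_ideal[OF assms(3)] a] .
    then have "a \<odot>\<^bsub>N\<^esub> f x = f (a \<odot>\<^bsub>M\<^esub> x)" using mod_homD(3)[OF assms(4) _ x] by simp
    then show ?thesis using n a mod_hom_zero[OF assms(1,2,4)] by simp
  qed
  then show ?thesis using mod_homD(1)[OF assms(4) x] by (auto simp: torsion_part_def)
qed

lemma mod_hom_minus:
  assumes "module R M" "module R N" "f \<in> mod_hom R M N" "x \<in> carrier M"
  shows "f (\<ominus>\<^bsub>M\<^esub> x) = \<ominus>\<^bsub>N\<^esub> f x"
proof -
  interpret M: module R M by fact
  interpret N: module R N by fact
  have "\<ominus>\<^bsub>M\<^esub> x = (\<ominus>\<^bsub>R\<^esub> \<one>\<^bsub>R\<^esub>) \<odot>\<^bsub>M\<^esub> x" using assms(4) by (simp add: M.smult_l_minus)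
  also have "f \<dots> = (\<ominus>\<^bsub>R\<^esub> \<one>\<^bsub>R\<^esub>) \<odot>\<^bsub>N\<^esub> f x" by (rule mod_homD(3)[OF assms(3) _ assms(4)]) simp
  also have "\<dots> = \<ominus>\<^bsub>N\<^esub> f x" using mod_homD(1)[OF assms(3,4)] by (simp add: N.smult_l_minus)
  finally show ?thesis .
qed

lemma mod_hom_image_submodule:
  assumes M: "module R M" and N: "module R N" and f: "f \<in> mod_hom R M N" and T: "submodule T R M"
  shows "submodule (f ` T) R N"
proof -
  interpret M: module R M by fact
  interpret N: module R N by fact
  note TE = M.submoduleE[OF T]
  have c: "x \<in> carrier M" if "x \<in> T" for x using TE(1) that by blast
  have z: "\<zero>\<^bsub>M\<^esub> \<in> T" using subgroup.one_closed[of T "add_monoid M"] T by (simp add: submodule_def)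
  note fD = mod_homD[OF f]
  show ?thesis
  proof (rule N.submoduleI)
    show "f ` T \<subseteq> carrier N" using c fD(1) by blast
    show "\<zero>\<^bsub>N\<^esub> \<in> f ` T" using z mod_hom_zero[OF M N f] by (metis imageI)
    show "\<ominus>\<^bsub>N\<^esub> y \<in> f ` T" if "y \<in> f ` T" for y
      using that TE(3) c by (auto simp: mod_hom_minus[OF M N f, symmetric])
    show "y \<oplus>\<^bsub>N\<^esub> y' \<in> f ` T" if "y \<in> f ` T" "y' \<in> f ` T" for y y'
      using that TE(5) c by (auto simp: fD(2)[symmetric])
    show "r \<odot>\<^bsub>N\<^esub> y \<in> f ` T" if "r \<in> carrier R" "y \<in> f ` T" for r y
      using that TE(4) c by (auto simp: fD(3)[symmetric])
  qed
qed

lemma mod_hom_kernel_submodule: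
  assumes M: "module R M" and N: "module R N" and f: "f \<in> mod_hom R M N" and T: "submodule T R M"
  shows "submodule {x \<in> T. f x = \<zero>\<^bsub>N\<^esub>} R M"
proof -
  interpret M: module R M by fact
  interpret N: module R N by fact
  note TE = M.submoduleE[OF T]
  have c: "x \<in> carrier M" if "x \<in> T" for x using TE(1) that by blast
  have z: "\<zero>\<^bsub>M\<^esub> \<in> T" using subgroup.one_closed[of T "add_monoid M"] T by (simp add: submodule_def)
  note fD = mod_homD[OF f]
  show ?thesis
    by (rule M.submoduleI)
      (use c z TE(3-5) fD(2,3) mod_hom_zero[OF M N f] mod_hom_minus[OF M N f] in auto)
qed

text \<open>A class is represented by an element of \<open>torsion_part R I (J l)\<close>, which
  some power of \<open>I\<close> kills; the same power of each single \<open>r \<in> I\<close> lies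
  there and kills the class. For the module structure the boundaries must form a submodule of the
  cocycles.\<close>

lemma local_cohomology_torsion:
  assumes I: "ideal I R" and res: "injective_resolution R M \<epsilon> J d"
  shows "module R (local_cohomology R I J d l) \<and> torsion_on R I (local_cohomology R I J d l)"
proof -
  have J: "module R (J n)" and d: "d n \<in> mod_hom R (J n) (J (Suc n))"
    and dd: "d n ` carrier (J n) = {x \<in> carrier (J (Suc n)). d (Suc n) x = \<zero>\<^bsub>J (Suc (Suc n))\<^esub>}" for n
    using res by (auto simp: injective_resolution_def injective_module_def)
  interpret Jl: module R "J l" by (rule J)
  define K where "K = {x \<in> torsion_part R I (J l). d l x = \<zero>\<^bsub>J (Suc l)\<^esub>}"
  \<comment> \<open>In degree zero the incoming differential starts at \<open>J (-1) = 0\<close>, so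
    the only boundary is zero.\<close>
  define B where "B = (case l of 0 \<Rightarrow> {\<zero>\<^bsub>J 0\<^esub>} | Suc k \<Rightarrow> d k ` torsion_part R I (J k))"
  let ?Z = "(J l)\<lparr>carrier := K\<rparr>"
  have K: "submodule K R (J l)"
    unfolding K_def by (rule mod_hom_kernel_submodule[OF J J d torsion_part_submodule[OF J I]])
  have Z: "module R ?Z" by (rule submodule.submodule_is_module[OF K J])
  interpret Z: module R ?Z by (rule Z)
  have "submodule B R (J l) \<and> B \<subseteq> K"
  proof (cases l)
    case 0
    have "submodule {\<zero>\<^bsub>J l\<^esub>} R (J l)" by (rule Jl.submoduleI) auto
    then show ?thesis using Z.M.zero_closed 0 by (simp add: B_def)
  next
    case (Suc k)
    have "submodule B R (J l)"
      unfolding B_def Suc using mod_hom_image_submodule[OF J J d torsion_part_submodule[OF J I]] by simp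
    \<comment> \<open>Consecutive differentials compose to zero by exactness of the resolution, and
      homomorphisms preserve torsion.\<close>
    moreover have "d k x \<in> K" if "x \<in> torsion_part R I (J k)" for x
    proof -
      have "x \<in> carrier (J k)" using that by (simp add: torsion_part_def)
      then have "d (Suc k) (d k x) = \<zero>\<^bsub>J (Suc (Suc k))\<^esub>" using dd[of k] by blast
      then show ?thesis unfolding K_def Suc using mod_hom_torsion_part[OF J J I d that] by simp
    qed
    ultimately show ?thesis by (auto simp: B_def Suc)
  qed
  then have "submodule B R (J l)" and "B \<subseteq> K" by simp_all
  \<comment> \<open>The quotient is formed inside the cocycles \<open>?Z\<close>, so
    \<open>B\<close> has to be a submodule of \<open>?Z\<close> and not merely of
    \<open>J l\<close>.\<close>
  then have B: "submodule B R ?Z"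
    using submodule.submodule_is_module[OF _ J, of B l] by (intro Z.module_incl_imp_submodule) simp_all
  have H: "local_cohomology R I J d l = quotient_module ?Z B"
    by (simp add: local_cohomology_def K_def B_def)
  have "\<exists>n::nat. (r [^]\<^bsub>R\<^esub> n) \<odot>\<^bsub>quotient_module ?Z B\<^esub> C = \<zero>\<^bsub>quotient_module ?Z B\<^esub>"
    if r: "r \<in> I" and C: "C \<in> carrier (quotient_module ?Z B)" for r C
  proof -
    obtain x where x: "x \<in> K" "C = B +>\<^bsub>?Z\<^esub> x" using C by (auto simp: Z.carrier_quotient_module)
    obtain n :: nat where n: "\<forall>a\<in>I [^]\<^bsub>ideals_set R\<^esub> n. a \<odot>\<^bsub>J l\<^esub> x = \<zero>\<^bsub>J l\<^esub>"
      using x(1) by (auto simp: K_def torsion_part_def)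
    have "r \<in> carrier R" using ideal.Icarr[OF I r] .
    then have "(r [^]\<^bsub>R\<^esub> n) \<odot>\<^bsub>quotient_module ?Z B\<^esub> C = B +>\<^bsub>?Z\<^esub> ((r [^]\<^bsub>R\<^esub> n) \<odot>\<^bsub>?Z\<^esub> x)"
      using Z.smult_quotient_module[OF B] x by simp
    also have "(r [^]\<^bsub>R\<^esub> n) \<odot>\<^bsub>?Z\<^esub> x = \<zero>\<^bsub>?Z\<^esub>" using n Jl.R.pow_in_ideal_power[OF I r] by simp
    also have "B +>\<^bsub>?Z\<^esub> \<zero>\<^bsub>?Z\<^esub> = B"
      using Z.rcoset_eq_iff[OF B Z.M.zero_closed] subgroup.one_closed[of B "add_monoid ?Z"] B
      by (simp add: submodule_def)
    finally show ?thesis by (auto simp: Z.zero_quotient_module)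
  qed
  then show ?thesis unfolding H torsion_on_def using Z.module_quotient_module[OF B] by blast
qed

section \<open>Regularity on the dual via coregularity on local cohomology\<close>

theorem theorem5:
  fixes R :: "('a, 'r) ring_scheme" and \<mm> I :: "'a set" and h h' :: nat and rs :: "'a list"
    and E :: "('a, 'e) module" and \<iota> :: "'a set \<Rightarrow> 'e"
    and J :: "nat \<Rightarrow> ('a, 'j) module" and \<epsilon> :: "'a \<Rightarrow> 'j" and d :: "nat \<Rightarrow> 'j \<Rightarrow> 'j"
  assumes "noetherian_local_ring R \<mm>"
    and "injective_hull R (quotient_module (ring_module R) \<mm>) E \<iota>"
    and "injective_resolution R (ring_module R) \<epsilon> J d"
    and "ideal I R"
    and "\<And>l. \<not> zero_module (local_cohomology R I J d l) \<longleftrightarrow> l = h"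
    and "1 \<le> h'" and "h' \<le> h"
    and "length rs = h'" and "set rs \<subseteq> I"
    and "regular_sequence R (ring_module R) rs"
    and "regular_sequence R (matlis_dual R E (local_cohomology R I J d h)) rs"
  shows "(\<forall>rs'. length rs' = h' \<and> set rs' \<subseteq> I \<and> Idl\<^bsub>R\<^esub> (set rs') = Idl\<^bsub>R\<^esub> (set rs) \<longrightarrow>
            regular_sequence R (matlis_dual R E (local_cohomology R I J d h)) rs') \<and>
         (\<forall>\<sigma>. \<sigma> permutes {..<h'} \<longrightarrow>
            regular_sequence R (matlis_dual R E (local_cohomology R I J d h)) (permute_list \<sigma> rs))"
proof -
  let ?H = "local_cohomology R I J d h"
  have H: "module R ?H" and tor: "torsion_on R I ?H"
    using local_cohomology_torsion[OF assms(4,3)] by simp_all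
  interpret H: module R ?H by (rule H)
  have IR: "I \<subseteq> carrier R" using ideal.Icarr[OF assms(4)] by blast
  have rsR: "set rs \<subseteq> carrier R" using assms(9) IR by blast
  note dual = regular_sequence_dual_iff[OF assms(1,2) H]
  have cor: "coregular ?H rs" and nz: "annihilated ?H (set rs) \<noteq> {\<zero>\<^bsub>?H\<^esub>}"
    using assms(11) dual[OF rsR] by simp_all
  \<comment> \<open>Nonvanishing passes to \<open>us\<close> because the annihilated submodule
    depends only on the generated ideal; coregularity passes by exchange.\<close>
  have main: "regular_sequence R (matlis_dual R E ?H) us"
    if us: "set us \<subseteq> I" "length us = h'" "Idl\<^bsub>R\<^esub> (set us) = Idl\<^bsub>R\<^esub> (set rs)" for us
  proof -
    have usR: "set us \<subseteq> carrier R" using us(1) IR by blast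
    have "annihilated ?H (set us) = annihilated ?H (set rs)"
      using H.annihilated_genideal[OF usR] H.annihilated_genideal[OF rsR] us(3) by simp
    moreover have "coregular ?H us"
      using coregular_generators[OF assms(1) H assms(4) tor cor assms(9) nz us(1) _ us(3)]
        us(2) assms(8) by simp
    ultimately show ?thesis using dual[OF usR] nz by simp
  qed
  \<comment> \<open>A permuted list has the same entries, so it generates the same ideal.\<close>
  moreover have "regular_sequence R (matlis_dual R E ?H) (permute_list \<sigma> rs)"
    if "\<sigma> permutes {..<h'}" for \<sigma>
    using main[of "permute_list \<sigma> rs"] that assms(8,9) by simp
  ultimately show ?thesis by blast
qed

end
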